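(* Suppose that $g$ is a meromorphic function on $\mathbb{C}$ with zero order, and $0<|q|<1$. Then $g$ takes every complex value infinitely often, with at most two possible Hahn-Picard exceptional values.
   Context: For $q\in\mathbb{C}\setminus\{0,1\}$, a complex constant $c$, and $g$ meromorphic on $\mathbb{C}$, the Hahn difference operator is $\mathcal{D}_{q,c}g(z)=\frac{g(qz+c)-g(z)}{(q-1)z+c}$. The order of $g$ is $\rho(g)=\limsup_{r\to\infty}\frac{\log^{+}T(r,g)}{\log r}$, where $T(r,g)$ is the Nevanlinna characteristic function. For $a\in\mathbb{C}$, $\hat n_{q,c}(r,g=a)$ is the sum, over all points $z_0$ with $|z_0|\le r$ and $g(z_0)=a$, of the integers $n-m$, where $n$ is the multiplicity of $z_0$ as a zero of $g-a$, $m=\min\{n,m'\}$, and $m'$ is the multiplicity of $z_0$ as a zero of $\mathcal{D}_{q,c}g$ ($m'=0$ if it is not a zero). Similarly, $\hat n_{q,c}(r,g=\infty)$ is the sum, over all poles $z_0$ of $g$ with $|z_0|\le r$, of the integers $n-m$, where $n$ is the multiplicity of the pole, $m=\min\{n,m'\}$, and $m'$ is the multiplicity of $z_0$ as a zero of $\mathcal{D}_{q,c}\left(\frac{1}{g(z)}\right)=-\frac{\mathcal{D}_{q,c}g(z)}{g(qz+c)g(z)}$ ($m'=0$ if it is not a zero). A value $a\in\mathbb{C}\cup\{\infty\}$ is called a Hahn-Picard exceptional value of $g$ if $\hat n_{q,c}(r,g=a)=O(1)$ as $r\to\infty$.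
   Formalization: The function g is additionally assumed to be transcendental (not rational): rational functions such as g(z)=z have zero order but take each value only finitely often, or are constant, so the claim fails for all of them. *)

theory Defs
  imports "HOL-Complex_Analysis.Complex_Analysis" "HOL-Library.Landau_Symbols"
    "HOL-Library.Extended_Nat"
begin

text \<open>
  A meromorphic function on the plane is a function \<^term>\<open>g\<close> with
  \<^prop>\<open>g nicely_meromorphic_on UNIV\<close>: it is continuous away from its poles and has the
  dummy value 0 at each pole. Hence \<^prop>\<open>g z = 0\<close> alone does not say that \<^term>\<open>z\<close>
  is a zero, and the multiplicities and value-taking predicates below always
  distinguish poles.
\<close>

text \<open>
  The multiplicities depend on \<^term>\<open>f\<close> only in a punctured neighbourhood of
  \<^term>\<open>z\<close>. In particular, removable singularities are filled in, such as that of a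
  difference quotient at the fixed point of \<open>z \<mapsto> q * z + c\<close>. The multiplicity is 0
  where \<^term>\<open>f\<close> has a nonzero value or a pole. It is infinite where \<^term>\<open>f\<close>
  vanishes identically; \<^const>\<open>zorder\<close> is unspecified there.
\<close>

definition zero_mult :: "(complex \<Rightarrow> complex) \<Rightarrow> complex \<Rightarrow> enat" where
  "zero_mult f z = (if \<forall>\<^sub>F w in at z. f w = 0 then \<infinity> else enat (nat (zorder f z)))"

definition pole_mult :: "(complex \<Rightarrow> complex) \<Rightarrow> complex \<Rightarrow> enat" where
  "pole_mult f z = (if is_pole f z then enat (nat (- zorder f z)) else 0)"

definition log_plus :: "real \<Rightarrow> real" where
  "log_plus x = ln (max 1 x)"

definition pole_count :: "(complex \<Rightarrow> complex) \<Rightarrow> real \<Rightarrow> nat" where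
  "pole_count g r = (\<Sum>z | cmod z \<le> r \<and> is_pole g z. the_enat (pole_mult g z))"

definition nevanlinna_N :: "(complex \<Rightarrow> complex) \<Rightarrow> real \<Rightarrow> real" where
  "nevanlinna_N g r =
     integral {0..r} (\<lambda>t. (real (pole_count g t) - real (pole_count g 0)) / t)
     + real (pole_count g 0) * ln r"

definition nevanlinna_m :: "(complex \<Rightarrow> complex) \<Rightarrow> real \<Rightarrow> real" where
  "nevanlinna_m g r =
     1 / (2 * pi) * integral {0..2 * pi} (\<lambda>\<theta>. log_plus (cmod (g (of_real r * cis \<theta>))))"

definition nevanlinna_T :: "(complex \<Rightarrow> complex) \<Rightarrow> real \<Rightarrow> real" where
  "nevanlinna_T g r = nevanlinna_m g r + nevanlinna_N g r"

definition mero_order :: "(complex \<Rightarrow> complex) \<Rightarrow> ereal" where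
  "mero_order g = Limsup at_top (\<lambda>r. ereal (log_plus (nevanlinna_T g r) / ln r))"

text \<open>
  The second polynomial is required to be nonzero only as a polynomial; its roots are
  finite in number and do not affect \<^term>\<open>g\<close> as a meromorphic function.
\<close>

definition transcendental :: "(complex \<Rightarrow> complex) \<Rightarrow> bool" where
  "transcendental g \<longleftrightarrow>
     \<not> (\<exists>p s :: complex poly. s \<noteq> 0 \<and> (\<forall>z. poly s z \<noteq> 0 \<longrightarrow> g z = poly p z / poly s z))"

definition hahn_diff ::
    "complex \<Rightarrow> complex \<Rightarrow> (complex \<Rightarrow> complex) \<Rightarrow> complex \<Rightarrow> complex" where
  "hahn_diff q c g z = (g (q * z + c) - g z) / ((q - 1) * z + c)"

text \<open>
  Values in the extended plane are of type \<^typ>\<open>complex option\<close>, with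
  \<^const>\<open>None\<close> for the point at infinity.
\<close>

fun takes_value :: "(complex \<Rightarrow> complex) \<Rightarrow> complex option \<Rightarrow> complex \<Rightarrow> bool" where
  "takes_value g (Some a) z \<longleftrightarrow> \<not> is_pole g z \<and> g z = a"
| "takes_value g None z \<longleftrightarrow> is_pole g z"

text \<open>The summand \<open>n - m\<close>, where \<open>m = min n m'\<close>, at a point \<^term>\<open>z\<close> where the value is taken.\<close>

fun hahn_mult ::
    "complex \<Rightarrow> complex \<Rightarrow> (complex \<Rightarrow> complex) \<Rightarrow> complex option \<Rightarrow> complex \<Rightarrow> nat" where
  "hahn_mult q c g (Some a) z =
     (let n = zero_mult (\<lambda>w. g w - a) z; m' = zero_mult (hahn_diff q c g) z
      in the_enat (n - min n m'))"
| "hahn_mult q c g None z =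
     (let n = pole_mult g z; m' = zero_mult (hahn_diff q c (\<lambda>w. 1 / g w)) z
      in the_enat (n - min n m'))"

definition hahn_count ::
    "complex \<Rightarrow> complex \<Rightarrow> (complex \<Rightarrow> complex) \<Rightarrow> complex option \<Rightarrow> real \<Rightarrow> nat" where
  "hahn_count q c g a r = (\<Sum>z | cmod z \<le> r \<and> takes_value g a z. hahn_mult q c g a z)"

definition hahn_picard_exceptional ::
    "complex \<Rightarrow> complex \<Rightarrow> (complex \<Rightarrow> complex) \<Rightarrow> complex option \<Rightarrow> bool" where
  "hahn_picard_exceptional q c g a \<longleftrightarrow> (\<lambda>r. real (hahn_count q c g a r)) \<in> O[at_top](\<lambda>_. 1)"

end

theory Submission
  imports Defs "HOL-Real_Asymp.Real_Asymp"
begin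

text \<open>
  Write \<open>g = A / B\<close> with entire \<open>A\<close>, \<open>B\<close> without common zeros, and let \<open>L z = q z + c\<close>. The points
  where \<open>g\<close> takes the value \<open>a\<close> are the zeros of \<open>l = A - a B\<close> (of \<open>l = B\<close> for \<open>a = \<infinity>\<close>). If \<open>a\<close> is
  exceptional, then at all but finitely many such points \<open>z\<close> the multiplicity of \<open>L z\<close> is at least
  that of \<open>z\<close>; since \<open>L\<close> is a contraction, this forces the two to be equal off a finite set, so
  \<open>l \<circ> L = R e\<^sup>\<phi> l\<close> with a rational \<open>R\<close> and an entire \<open>\<phi>\<close>.

  Suppose that there are three exceptional values, with forms \<open>l\<^sub>1, l\<^sub>2, l\<^sub>3\<close>. The zero order of \<open>g\<close> and
  Jensen's formula bound the mean of \<open>\<bar>log \<bar>l\<^sub>i / l\<^sub>j\<bar>\<bar>\<close> on circles and the number of zeros of each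
  \<open>l\<^sub>i\<close> in a disc of radius \<open>r\<close> by \<open>O(\<surd>r)\<close>. Factoring out the zeros in such a disc by Blaschke
  products, which telescope under \<open>L\<close>, gives \<open>Re (\<phi>\<^sub>i - \<phi>\<^sub>j) = O(\<surd>r log r)\<close>, so \<open>\<phi>\<^sub>i - \<phi>\<^sub>j\<close> is
  constant. Comparing the linear relation between the three forms with its image under \<open>L\<close> then
  shows that \<open>g\<close> is rational or that \<open>g \<circ> L = g\<close>; in the latter case \<open>g\<close> is constant, by continuity
  at the fixed point of \<open>L\<close>.
\<close>

section \<open>The Schwarz integral formula\<close>

definition circ_mean :: "(complex \<Rightarrow> real) \<Rightarrow> real \<Rightarrow> real" where
  "circ_mean u r = 1 / (2 * pi) * integral {0..2 * pi} (\<lambda>\<theta>. u (of_real r * cis \<theta>))"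

lemma nevanlinna_m_eq_circ_mean: "nevanlinna_m g = circ_mean (\<lambda>z. log_plus (cmod (g z)))"
  by (simp add: fun_eq_iff nevanlinna_m_def circ_mean_def)

lemma circ_continuous:
  assumes "continuous_on (sphere 0 r) u" "r \<ge> 0"
  shows "continuous_on S (\<lambda>\<theta>. u (of_real r * cis \<theta>))"
  by (rule continuous_on_compose2[OF assms(1)])
     (use assms(2) in \<open>auto intro!: continuous_intros simp: norm_mult\<close>)

lemma circ_integrable:
  fixes u :: "complex \<Rightarrow> 'a::euclidean_space"
  assumes "continuous_on (sphere 0 r) u" "r \<ge> 0"
  shows "(\<lambda>\<theta>. u (of_real r * cis \<theta>)) integrable_on {0..2*pi}"
  by (intro integrable_continuous_interval circ_continuous assms)

lemma circ_mean_mono: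
  assumes "continuous_on (sphere 0 r) u" "continuous_on (sphere 0 r) v" "r \<ge> 0"
    and "\<And>z. cmod z = r \<Longrightarrow> u z \<le> v z"
  shows "circ_mean u r \<le> circ_mean v r"
  unfolding circ_mean_def
  by (intro mult_left_mono integral_le circ_integrable assms) (use assms(3) in \<open>auto simp: norm_mult\<close>)

lemma circ_mean_add:
  assumes "continuous_on (sphere 0 r) u" "continuous_on (sphere 0 r) v" "r \<ge> 0"
  shows "circ_mean (\<lambda>z. u z + v z) r = circ_mean u r + circ_mean v r"
  unfolding circ_mean_def
  by (subst integral_add) (intro circ_integrable assms, intro circ_integrable assms, simp add: distrib_left)

lemma circ_mean_cmult: "circ_mean (\<lambda>z. k * u z) r = k * circ_mean u r"
  unfolding circ_mean_def by simp

lemma circ_mean_const: "circ_mean (\<lambda>_. k) r = k"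
  unfolding circ_mean_def by simp

lemma circ_mean_cong:
  assumes "r \<ge> 0" "\<And>z. cmod z = r \<Longrightarrow> u z = v z"
  shows "circ_mean u r = circ_mean v r"
  unfolding circ_mean_def
  by (intro arg_cong2[where f = "(*)"] refl integral_cong) (use assms in \<open>auto simp: norm_mult\<close>)

lemma circ_mean_abs:
  assumes "continuous_on (sphere 0 r) u" "r \<ge> 0"
  shows "\<bar>circ_mean u r\<bar> \<le> circ_mean (\<lambda>z. \<bar>u z\<bar>) r"
proof -
  have "circ_mean u r \<le> circ_mean (\<lambda>z. \<bar>u z\<bar>) r"
    by (intro circ_mean_mono assms continuous_intros) auto
  moreover have "circ_mean (\<lambda>z. -1 * u z) r \<le> circ_mean (\<lambda>z. \<bar>u z\<bar>) r"
    by (intro circ_mean_mono assms continuous_intros) auto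
  ultimately show ?thesis
    unfolding circ_mean_cmult by linarith
qed

section \<open>Cauchy and Schwarz formulas in terms of the angle\<close>

lemma Cauchy_circle:
  fixes f :: "complex \<Rightarrow> complex"
  assumes f: "f holomorphic_on ball 0 R" and r: "0 < r" "r < R" and w: "cmod w < r"
  shows "((\<lambda>\<theta>. f (of_real r * cis \<theta>) * (of_real r * cis \<theta>) / (of_real r * cis \<theta> - w))
           has_integral 2 * pi * f w) {0..2*pi}"
proof -
  have f': "f holomorphic_on cball 0 r"
    using f by (rule holomorphic_on_subset) (use r in auto)
  have "((\<lambda>u. f u / (u - w)) has_contour_integral (2 * of_real pi * \<i> * f w)) (circlepath 0 r)"
    by (rule Cauchy_integral_circlepath_simple[OF f']) (use w in auto)
  hence "((\<lambda>t. f (0 + r * cis t) / (0 + r * cis t - w) * r * \<i> * cis t) has_integral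
           (2 * of_real pi * \<i> * f w)) {0..2*pi}"
    unfolding circlepath_def by (subst (asm) has_contour_integral_part_circlepath_iff) auto
  \<comment> \<open>Along the circle \<open>du = \<i> u dt\<close>; the factor \<open>-\<i>\<close>
    cancels the \<open>\<i>\<close> and leaves an angular integral with an extra \<open>u\<close> in
    the numerator.\<close>
  hence "((\<lambda>t. (f (0 + r * cis t) / (0 + r * cis t - w) * r * \<i> * cis t) * (-\<i>)) has_integral
           (2 * of_real pi * \<i> * f w) * (-\<i>)) {0..2*pi}"
    by (rule has_integral_mult_left)
  thus ?thesis by (simp add: field_simps)
qed

lemma Cauchy_circle_0:
  fixes f :: "complex \<Rightarrow> complex"
  assumes f: "f holomorphic_on ball 0 R" and r: "0 < r" "r < R"
  shows "((\<lambda>\<theta>. f (of_real r * cis \<theta>)) has_integral 2 * pi * f 0) {0..2*pi}"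
  using Cauchy_circle[OF assms, of 0] r by simp

lemma circ_mean_Re_holomorphic:
  fixes f :: "complex \<Rightarrow> complex"
  assumes f: "f holomorphic_on ball 0 R" and r: "0 < r" "r < R"
  shows "circ_mean (\<lambda>z. Re (f z)) r = Re (f 0)"
proof -
  have "((\<lambda>\<theta>. Re (f (of_real r * cis \<theta>))) has_integral Re (2 * pi * f 0)) {0..2*pi}"
    using has_integral_linear[OF Cauchy_circle_0[OF assms] bounded_linear_Re] by (simp add: o_def)
  thus ?thesis unfolding circ_mean_def by (simp add: integral_unique)
qed

text \<open>
  Writing \<open>\<zeta>\<close> for the point on the circle, the conjugate of \<open>w / (\<zeta> - w)\<close> extends
  holomorphically to the disc and vanishes at 0, so that \<open>cnj f\<close> times \<open>w / (\<zeta> - w)\<close>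
  has mean 0 and may be added to the Cauchy integral for free.
\<close>

lemma Schwarz_integral:
  fixes f :: "complex \<Rightarrow> complex"
  assumes f: "f holomorphic_on ball 0 R" and r: "0 < r" "r < R" and w: "cmod w < r"
  shows "((\<lambda>\<theta>. of_real (2 * Re (f (of_real r * cis \<theta>))) * w / (of_real r * cis \<theta> - w))
           has_integral 2 * pi * (f w - f 0)) {0..2*pi}"
proof -
  \<comment> \<open>The pole of \<open>h\<close> has modulus \<open>r^2 / cmod w > r\<close>. With
    the midpoint of \<open>cmod w\<close> and \<open>r\<close> in place of \<open>cmod w\<close>,
    the radius stays above \<open>r\<close> and short of the pole, also when
    \<open>w = 0\<close>.\<close>
  define R' where "R' = min R (r\<^sup>2 / (cmod w + (r - cmod w) / 2))"
  have pos: "cmod w + (r - cmod w) / 2 > 0" "cmod w + (r - cmod w) / 2 < r"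
    using w r by (auto simp: field_simps) (smt (verit) norm_ge_zero)
  have R': "R' > r" "R' \<le> R"
    using r pos by (auto simp: R'_def power2_eq_square field_simps)
  define h where "h = (\<lambda>z. f z * (cnj w * z / (of_real (r\<^sup>2) - cnj w * z)))"
  have nz: "of_real (r\<^sup>2) - cnj w * z \<noteq> 0" if "cmod z < R'" for z
  proof
    assume "of_real (r\<^sup>2) - cnj w * z = 0"
    hence "cmod (cnj w * z) = cmod (of_real (r\<^sup>2))" by simp
    hence eq: "cmod w * cmod z = r\<^sup>2" by (simp add: norm_mult norm_power)
    have "cmod w * cmod z \<le> (cmod w + (r - cmod w) / 2) * cmod z"
      using w by (intro mult_right_mono) auto
    also have "\<dots> < (cmod w + (r - cmod w) / 2) * R'"
      using that pos by (intro mult_strict_left_mono) auto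
    also have "\<dots> \<le> (cmod w + (r - cmod w) / 2) * (r\<^sup>2 / (cmod w + (r - cmod w) / 2))"
      using pos by (intro mult_left_mono) (auto simp: R'_def)
    also have "\<dots> = r\<^sup>2" using pos by simp
    finally show False using eq by simp
  qed
  have "h holomorphic_on ball 0 R'"
    unfolding h_def using nz R' by (auto intro!: holomorphic_intros holomorphic_on_subset[OF f])
  from Cauchy_circle_0[OF this r(1) R'(1)]
  have 1: "((\<lambda>\<theta>. h (of_real r * cis \<theta>)) has_integral 0) {0..2*pi}"
    by (simp add: h_def)
  have 2: "((\<lambda>\<theta>. cnj (h (of_real r * cis \<theta>))) has_integral 0) {0..2*pi}"
    using has_integral_linear[OF 1 bounded_linear_cnj] by (simp add: o_def)
  have 3: "((\<lambda>\<theta>. f (of_real r * cis \<theta>) * (of_real r * cis \<theta>) / (of_real r * cis \<theta> - w)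
      - f (of_real r * cis \<theta>) + cnj (h (of_real r * cis \<theta>)))
           has_integral 2 * pi * f w - 2 * pi * f 0 + 0) {0..2*pi}"
    by (intro has_integral_add has_integral_diff Cauchy_circle[OF f r w] Cauchy_circle_0[OF f r] 2)
  have eq: "f z * z / (z - w) - f z + cnj (h z) = of_real (2 * Re (f z)) * w / (z - w)"
    if z: "z = of_real r * cis \<theta>" for z \<theta>
  proof -
    have zr: "cmod z = r" using r z by (simp add: norm_mult)
    have zw: "z - w \<noteq> 0" using zr w by auto
    have z0: "z \<noteq> 0" using zr r by auto
    \<comment> \<open>On the circle this turns the denominator of \<open>cnj (h z)\<close> into a
      multiple of \<open>z - w\<close>, so that the integrands combine to \<open>f + cnj f\<close>,
      twice the real part.\<close>
    have "of_real (r\<^sup>2) = z * cnj z" using zr complex_norm_square[of z] by simp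
    hence "cnj (h z) = cnj (f z) * (w * cnj z / (cnj z * (z - w)))"
      by (simp add: h_def algebra_simps)
    also have "\<dots> = cnj (f z) * w / (z - w)"
      using z0 by simp
    finally have "f z * z / (z - w) - f z + cnj (h z) = (f z + cnj (f z)) * w / (z - w)"
      using zw by (simp add: field_simps)
    thus ?thesis by (simp add: complex_add_cnj)
  qed
  show ?thesis
    using 3 unfolding eq[OF refl] by (simp add: algebra_simps)
qed

text \<open>On the circle the kernel \<open>w / (\<zeta> - w)\<close> has modulus at most
  \<open>cmod w / (r - cmod w)\<close>. So the mean of \<open>\<bar>Re f\<bar>\<close> alone
  controls the variation of \<open>f\<close>, imaginary part included.\<close>

lemma Schwarz_bound:
  fixes f :: "complex \<Rightarrow> complex"
  assumes f: "f holomorphic_on ball 0 R" and r: "0 < r" "r < R" and w: "cmod w < r"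
  shows "cmod (f w - f 0) \<le> 2 * cmod w / (r - cmod w) * circ_mean (\<lambda>z. \<bar>Re (f z)\<bar>) r"
proof -
  let ?F = "\<lambda>\<theta>. of_real (2 * Re (f (of_real r * cis \<theta>))) * w / (of_real r * cis \<theta> - w)"
  let ?G = "\<lambda>\<theta>. 2 * cmod w / (r - cmod w) * \<bar>Re (f (of_real r * cis \<theta>))\<bar>"
  note I = Schwarz_integral[OF assms]
  have cont: "continuous_on (sphere 0 r) (\<lambda>z. 2 * cmod w / (r - cmod w) * \<bar>Re (f z)\<bar>)"
    by (intro continuous_intros holomorphic_on_imp_continuous_on holomorphic_on_subset[OF f])
       (use r in auto)
  have "norm (integral {0..2*pi} ?F) \<le> integral {0..2*pi} ?G"
  proof (rule integral_norm_bound_integral)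
    show "?F integrable_on {0..2*pi}" using I by blast
    show "?G integrable_on {0..2*pi}" using circ_integrable[OF cont] r by simp
    fix \<theta>
    have le: "r - cmod w \<le> cmod (of_real r * cis \<theta> - w)"
      using norm_triangle_ineq2[of "of_real r * cis \<theta>" w] r by (simp add: norm_mult)
    have "norm (?F \<theta>) = 2 * \<bar>Re (f (of_real r * cis \<theta>))\<bar> * cmod w / cmod (of_real r * cis \<theta> - w)"
      by (simp add: norm_mult norm_divide)
    also have "\<dots> \<le> 2 * \<bar>Re (f (of_real r * cis \<theta>))\<bar> * cmod w / (r - cmod w)"
      by (intro divide_left_mono mult_pos_pos le) (use w le in auto)
    finally show "norm (?F \<theta>) \<le> ?G \<theta>" by (simp add: mult_ac)
  qed
  also have "integral {0..2*pi} ?F = 2 * pi * (f w - f 0)"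
    using I by (rule integral_unique)
  finally have *: "2 * pi * cmod (f w - f 0) \<le> integral {0..2*pi} ?G"
    by (simp add: norm_mult)
  have "cmod (f w - f 0) = 1 / (2 * pi) * (2 * pi * cmod (f w - f 0))"
    by simp
  also have "\<dots> \<le> 1 / (2 * pi) * integral {0..2*pi} ?G"
    using * by (rule mult_left_mono) auto
  also have "1 / (2 * pi) * integral {0..2*pi} ?G = 2 * cmod w / (r - cmod w) * circ_mean (\<lambda>z. \<bar>Re (f z)\<bar>) r"
    unfolding circ_mean_cmult[symmetric] by (simp add: circ_mean_def)
  finally show ?thesis .
qed

text \<open>In the half disc the factor in \<open>Schwarz_bound\<close> is at most 2; the mean value
  property bounds \<open>\<bar>Re (f 0)\<bar>\<close> by one more mean.\<close>

lemma Re_bound_half_disc: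
  fixes f :: "complex \<Rightarrow> complex"
  assumes f: "f holomorphic_on ball 0 R" and r: "0 < r" "r < R" and w: "cmod w \<le> r / 2"
  shows "\<bar>Re (f w)\<bar> \<le> 3 * circ_mean (\<lambda>z. \<bar>Re (f z)\<bar>) r"
proof -
  let ?m = "circ_mean (\<lambda>z. \<bar>Re (f z)\<bar>) r"
  have cont: "continuous_on (sphere 0 r) (\<lambda>z. Re (f z))"
    by (intro continuous_intros holomorphic_on_imp_continuous_on holomorphic_on_subset[OF f])
       (use r in auto)
  have 0: "\<bar>Re (f 0)\<bar> \<le> ?m"
    using circ_mean_abs[OF cont] r circ_mean_Re_holomorphic[OF f r] by simp
  have "cmod (f w - f 0) \<le> 2 * cmod w / (r - cmod w) * ?m"
    using w r by (intro Schwarz_bound[OF f r]) auto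
  also have "\<dots> \<le> 2 * ?m"
    using w r 0 by (intro mult_right_mono) (auto simp: field_simps)
  finally have "\<bar>Re (f w - f 0)\<bar> \<le> 2 * ?m"
    using abs_Re_le_cmod order_trans by blast
  thus ?thesis using 0 by simp
qed

text \<open>A Liouville theorem for the real part, from \<open>Schwarz_bound\<close> on large
  circles. Smallness is asked only on arbitrarily large circles, which leaves the freedom to choose
  circles that avoid zeros.\<close>

lemma entire_Re_sublinear_imp_constant:
  fixes f :: "complex \<Rightarrow> complex"
  assumes f: "f holomorphic_on UNIV"
    and small: "\<And>e R. e > 0 \<Longrightarrow> \<exists>s\<ge>R. \<forall>z. cmod z = s \<longrightarrow> \<bar>Re (f z)\<bar> \<le> e * s"
  shows "f w = f 0"
proof (rule ccontr)
  assume ne: "f w \<noteq> f 0"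
  define d where "d = cmod (f w - f 0)"
  have d: "d > 0" using ne by (simp add: d_def)
  have w: "cmod w > 0" using ne by auto
  \<comment> \<open>For \<open>s \<ge> 2 * cmod w\<close> the bound below is at most
    \<open>4 * cmod w * e\<close>, and this choice makes it \<open>d / 2\<close>.\<close>
  define e where "e = d / (8 * cmod w)"
  have e: "e > 0" using d w by (simp add: e_def)
  obtain s where s: "s \<ge> 2 * cmod w + 1" "\<And>z. cmod z = s \<Longrightarrow> \<bar>Re (f z)\<bar> \<le> e * s"
    using small[OF e] by blast
  have s0: "s > 0" "cmod w < s" using s(1) w by linarith+
  have cont: "continuous_on (sphere 0 s) (\<lambda>z. \<bar>Re (f z)\<bar>)"
    by (intro continuous_intros holomorphic_on_imp_continuous_on holomorphic_on_subset[OF f]) auto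
  have "circ_mean (\<lambda>z. \<bar>Re (f z)\<bar>) s \<le> circ_mean (\<lambda>z. e * s) s"
    by (intro circ_mean_mono cont) (use s s0 in auto)
  hence m: "circ_mean (\<lambda>z. \<bar>Re (f z)\<bar>) s \<le> e * s"
    by (simp add: circ_mean_const)
  have "d \<le> 2 * cmod w / (s - cmod w) * circ_mean (\<lambda>z. \<bar>Re (f z)\<bar>) s"
    unfolding d_def by (rule Schwarz_bound[of f "s + 1"]) (use s0 in \<open>auto intro: holomorphic_on_subset[OF f]\<close>)
  also have "\<dots> \<le> 2 * cmod w / (s - cmod w) * (e * s)"
    using m s0 by (intro mult_left_mono) auto
  also have "\<dots> \<le> 2 * cmod w / (s / 2) * (e * s)"
    using s s0 e by (intro mult_right_mono divide_left_mono) auto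
  also have "\<dots> = d / 2" using s0(1)[THEN less_imp_neq] w by (simp add: e_def)
  finally show False using d by simp
qed

section \<open>Zero multiplicities and Blaschke factorization\<close>

definition entire_nz :: "(complex \<Rightarrow> complex) \<Rightarrow> bool" where
  "entire_nz f \<longleftrightarrow> f holomorphic_on UNIV \<and> (\<exists>z. f z \<noteq> 0)"

text \<open>The finite counterpart of \<open>zero_mult\<close>, meaningful for
  \<open>entire_nz\<close> functions, whose zeros have finite order
  (\<open>int_zmul\<close>).\<close>

definition zmul :: "(complex \<Rightarrow> complex) \<Rightarrow> complex \<Rightarrow> nat" where
  "zmul f z = nat (zorder f z)"

lemma entire_nz_holomorphic: "entire_nz f \<Longrightarrow> f holomorphic_on A"
  by (auto simp: entire_nz_def intro: holomorphic_on_subset)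

lemma entire_nz_analytic: "entire_nz f \<Longrightarrow> f analytic_on A"
  using entire_nz_holomorphic[of f UNIV] by (metis analytic_on_open analytic_on_subset open_UNIV subset_UNIV)

lemma entire_nz_continuous: "entire_nz f \<Longrightarrow> continuous_on A f"
  by (intro holomorphic_on_imp_continuous_on entire_nz_holomorphic)

lemma entire_nz_eventually:
  assumes "entire_nz f"
  shows "\<forall>\<^sub>F w in at z. f w \<noteq> 0"
proof -
  obtain z0 where "f z0 \<noteq> 0" using assms by (auto simp: entire_nz_def)
  then show ?thesis
    using non_zero_neighbour_alt[of f UNIV z z0] entire_nz_holomorphic[OF assms] by auto
qed

lemma entire_nz_frequently: "entire_nz f \<Longrightarrow> \<exists>\<^sub>F w in at z. f w \<noteq> 0"
  by (rule eventually_frequently) (auto intro: entire_nz_eventually)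

lemma int_zmul: "entire_nz f \<Longrightarrow> int (zmul f z) = zorder f z"
  unfolding zmul_def using zorder_ge_0[OF entire_nz_analytic entire_nz_frequently, of f z] by simp

lemma zmul_eq_0_iff: "entire_nz f \<Longrightarrow> zmul f z = 0 \<longleftrightarrow> f z \<noteq> 0"
  using zorder_eq_0_iff[OF entire_nz_analytic entire_nz_frequently, of f z] int_zmul[of f z] by auto

lemma finite_zeros_cball:
  assumes "entire_nz f"
  shows "finite {z. cmod z \<le> r \<and> f z = 0}"
proof (rule ccontr)
  assume inf: "infinite {z. cmod z \<le> r \<and> f z = 0}"
  have "{z. cmod z \<le> r \<and> f z = 0} \<subseteq> cball 0 r" by auto
  with inf obtain x where "x islimpt {z. cmod z \<le> r \<and> f z = 0}"
    by (meson compact_cball compact_eq_Bolzano_Weierstrass)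
  hence "x islimpt {z. f z = 0}"
    by (rule islimpt_subset) auto
  hence "\<exists>\<^sub>F w in at x. f w = 0"
    by (simp add: islimpt_conv_frequently_at)
  with entire_nz_eventually[OF assms, of x] show False
    by (simp add: frequently_def)
qed

lemma entire_nz_mult:
  assumes "entire_nz f" "entire_nz g"
  shows "entire_nz (\<lambda>z. f z * g z)"
proof -
  have "\<forall>\<^sub>F w in at 0. f w \<noteq> 0 \<and> g w \<noteq> 0"
    using assms by (intro eventually_conj entire_nz_eventually)
  then obtain w where "f w \<noteq> 0 \<and> g w \<noteq> 0"
    using eventually_happens'[OF at_neq_bot] by blast
  moreover have "(\<lambda>z. f z * g z) holomorphic_on UNIV"
    by (intro holomorphic_intros entire_nz_holomorphic assms)
  ultimately show ?thesis by (auto simp: entire_nz_def)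
qed

lemma zmul_mult:
  assumes "entire_nz f" "entire_nz g"
  shows "zmul (\<lambda>z. f z * g z) z = zmul f z + zmul g z"
proof -
  have "zorder (\<lambda>z. f z * g z) z = zorder f z + zorder g z"
    by (rule zorder_times_analytic)
       (use entire_nz_eventually[OF entire_nz_mult[OF assms]] in \<open>auto intro: entire_nz_analytic assms\<close>)
  thus ?thesis
    using int_zmul assms entire_nz_mult by (metis of_nat_add of_nat_eq_iff)
qed

lemma entire_nz_affine:
  assumes "entire_nz f" "q \<noteq> 0"
  shows "entire_nz (\<lambda>z. f (q * z + c))"
proof -
  obtain z where "f z \<noteq> 0" using assms by (auto simp: entire_nz_def)
  hence "f (q * ((z - c) / q) + c) \<noteq> 0" using assms by simp
  moreover have "(\<lambda>z. f (q * z + c)) holomorphic_on UNIV"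
    using holomorphic_on_compose[of "\<lambda>z. q * z + c" UNIV f] entire_nz_holomorphic[OF assms(1)]
    by (simp add: o_def holomorphic_intros)
  ultimately show ?thesis unfolding entire_nz_def by blast
qed

lemma zmul_affine:
  assumes "entire_nz f" "q \<noteq> 0"
  shows "zmul (\<lambda>z. f (q * z + c)) z = zmul f (q * z + c)"
proof -
  have "zorder (\<lambda>x. (q * x + c) - (q * z + c)) z = zorder (\<lambda>x. q * (x - z)) z"
    by (simp add: algebra_simps)
  also have "\<dots> = zorder (\<lambda>x. x - z) z" by (rule zorder_cmult) fact
  also have "\<dots> = 1" by (rule zorder_eqI[of UNIV _ "\<lambda>_. 1"]) auto
  finally have 1: "zorder (\<lambda>x. (q * x + c) - (q * z + c)) z = 1" .
  have "zorder (f \<circ> (\<lambda>z. q * z + c)) z = zorder f (q * z + c) * zorder (\<lambda>x. (q * x + c) - (q * z + c)) z"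
  proof (rule zorder_compose')
    show "isolated_singularity_at f (q * z + c)" "not_essential f (q * z + c)"
      using entire_nz_analytic[OF assms(1)] by (auto intro: isolated_singularity_at_analytic not_essential_analytic)
    show "(\<lambda>z. q * z + c) analytic_on {z}" by (auto intro!: analytic_intros)
    show "\<forall>\<^sub>F w in at z. q * w + c \<noteq> q * z + c"
      using assms(2) by (auto simp: eventually_at_filter)
  qed (auto intro: entire_nz_eventually assms)
  thus ?thesis unfolding 1 zmul_def by (simp add: o_def)
qed

section \<open>Polynomials with prescribed zeros, and exponential factors\<close>

definition lin_prod :: "complex set \<Rightarrow> (complex \<Rightarrow> nat) \<Rightarrow> complex \<Rightarrow> complex" where
  "lin_prod S m z = (\<Prod>a\<in>S. (z - a) ^ m a)"

lemma lin_prod_eq_0_iff: "finite S \<Longrightarrow> lin_prod S m z = 0 \<longleftrightarrow> z \<in> S \<and> m z > 0"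
  by (auto simp: lin_prod_def)

lemma entire_nz_lin_prod: 
  assumes "finite S"
  shows "entire_nz (lin_prod S m)"
proof -
  have "infinite (UNIV :: complex set)" by (rule infinite_UNIV_char_0)
  then obtain z where "z \<notin> S" using assms by (metis ex_new_if_finite)
  hence "lin_prod S m z \<noteq> 0" using assms by (simp add: lin_prod_eq_0_iff)
  moreover have "lin_prod S m holomorphic_on UNIV"
    unfolding lin_prod_def[abs_def] by (intro holomorphic_intros)
  ultimately show ?thesis by (auto simp: entire_nz_def)
qed

lemma zmul_lin_prod:
  assumes "finite S"
  shows "zmul (lin_prod S m) z = (if z \<in> S then m z else 0)"
proof -
  have ord: "zorder (\<lambda>w. (w - a) ^ m a) z = (if z = a then int (m a) else 0)" for a
  proof (cases "z = a")
    case True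
    thus ?thesis by (auto intro!: zorder_eqI[of UNIV _ "\<lambda>_. 1"])
  next
    case False
    thus ?thesis by (auto intro!: zorder_eq_0I analytic_intros)
  qed
  have "zorder (lin_prod S m) z = (\<Sum>a\<in>S. zorder (\<lambda>w. (w - a) ^ m a) z)"
    unfolding lin_prod_def[abs_def]
    by (rule zorder_prod_analytic)
       (use entire_nz_eventually[OF entire_nz_lin_prod[OF assms], of m z] in
         \<open>auto intro!: analytic_intros simp: lin_prod_def\<close>)
  also have "\<dots> = (\<Sum>a\<in>S. if z = a then int (m a) else 0)"
    by (simp only: ord)
  also have "\<dots> = (if z \<in> S then int (m z) else 0)"
    using assms by (simp add: sum.delta)
  finally show ?thesis by (simp add: zmul_def)
qed

text \<open>Equal orders make \<open>f / g\<close> extend to a zero-free function on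
  \<open>A\<close>. Convexity supplies both the connectedness for this quotient and the
  contractibility for its logarithm.\<close>

lemma exp_factorization:
  assumes f: "entire_nz f" and g: "entire_nz g" and A: "open A" "convex A" "A \<noteq> {}"
    and eq: "\<And>z. z \<in> A \<Longrightarrow> zmul f z = zmul g z"
  obtains k where "k holomorphic_on A" "\<And>z. z \<in> A \<Longrightarrow> f z = exp (k z) * g z"
proof -
  obtain h where h: "h holomorphic_on A" "\<And>z. z \<in> A \<Longrightarrow> h z \<noteq> 0" "\<And>z. z \<in> A \<Longrightarrow> f z = h z * g z"
  proof (rule holomorphic_zorder_factorization[of f A g])
    show "f holomorphic_on A" "g holomorphic_on A"
      using f g by (auto intro: entire_nz_holomorphic)
    show "g z = 0 \<longleftrightarrow> f z = 0" if "z \<in> A" for z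
      using zmul_eq_0_iff[OF f, of z] zmul_eq_0_iff[OF g, of z] eq[OF that] by auto
    show "zorder g z = zorder f z" if "z \<in> A" for z
      using int_zmul[OF f, of z] int_zmul[OF g, of z] eq[OF that] by simp
  qed (use A in \<open>auto intro: convex_connected\<close>)
  obtain k where "k holomorphic_on A" "\<And>z. z \<in> A \<Longrightarrow> h z = exp (k z)"
    using contractible_imp_holomorphic_log[of h A] h convex_imp_contractible[OF A(2)] by metis
  thus ?thesis using that h by simp
qed

section \<open>Blaschke products in a disc\<close>

definition zeros_in :: "(complex \<Rightarrow> complex) \<Rightarrow> real \<Rightarrow> complex set" where
  "zeros_in f r = {a. cmod a < r \<and> f a = 0}"

lemma finite_zeros_in: "entire_nz f \<Longrightarrow> finite (zeros_in f r)"
  unfolding zeros_in_def by (rule finite_subset[OF _ finite_zeros_cball[of f r]]) auto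

text \<open>This is \<open>f = exp \<kappa>\<close> times the Blaschke product with factors
  \<open>r (z - a) / (r^2 - cnj a * z)\<close>, cleared of denominators. \<open>R > r\<close> makes
  \<open>\<kappa>\<close> holomorphic across the circle, as the integral formulas require.\<close>

lemma blaschke_factorization:
  assumes f: "entire_nz f" and r: "r > 0" and gen: "\<And>z. cmod z = r \<Longrightarrow> f z \<noteq> 0"
  obtains R \<kappa> where "R > r" "\<kappa> holomorphic_on ball 0 R"
    "\<And>z. cmod z < R \<Longrightarrow>
       f z * (\<Prod>a\<in>zeros_in f r. (of_real (r\<^sup>2) - cnj a * z) ^ zmul f a) =
       exp (\<kappa> z) * (\<Prod>a\<in>zeros_in f r. (of_real r * (z - a)) ^ zmul f a)"
proof -
  let ?Z = "zeros_in f r"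
  \<comment> \<open>The radius must stay below the moduli of the zeros of \<open>f\<close> beyond
    the circle and of the zeros of the denominators. The cap \<open>r + 1\<close> leaves finitely
    many of them to consider.\<close>
  define T where "T = insert (r + 1) (cmod ` {z. cmod z \<le> r + 1 \<and> f z = 0 \<and> r < cmod z} \<union>
                        (\<lambda>a. r\<^sup>2 / cmod a) ` (?Z - {0}))"
  define R where "R = Min T"
  have fZ: "finite ?Z" using f by (rule finite_zeros_in)
  have fT: "finite T" unfolding T_def
    by (auto intro: fZ finite_subset[OF _ finite_zeros_cball[OF f, of "r + 1"]])
  have Tgt: "x > r" if "x \<in> T" for x
  proof -
    have Z: "r < r\<^sup>2 / cmod a" if "a \<in> ?Z - {0}" for a
    proof -
      have "r * cmod a < r * r" by (rule mult_strict_left_mono) (use that r in \<open>auto simp: zeros_in_def\<close>)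
      thus ?thesis using that by (simp add: pos_less_divide_eq power2_eq_square)
    qed
    from that consider "x = r + 1" | z where "x = cmod z" "r < cmod z"
      | a where "a \<in> ?Z - {0}" "x = r\<^sup>2 / cmod a"
      unfolding T_def by blast
    thus ?thesis using Z by cases simp_all
  qed
  have "T \<noteq> {}" by (simp add: T_def)
  hence R: "R > r" unfolding R_def by (intro Tgt Min_in fT)
  have Rle: "R \<le> x" if "x \<in> T" for x using that fT by (simp add: R_def)
  have R1: "R \<le> r + 1" by (rule Rle) (simp add: T_def)
  have zeros: "z \<in> ?Z" if "cmod z < R" "f z = 0" for z
  proof (rule ccontr)
    assume "z \<notin> ?Z"
    hence "cmod z > r" using gen[of z] that by (force simp: zeros_in_def)
    hence "cmod z \<in> T" using that R1 by (auto simp: T_def)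
    from Rle[OF this] show False using that by simp
  qed
  have nz: "of_real (r\<^sup>2) - cnj a * z \<noteq> 0" if "a \<in> ?Z" "cmod z < R" for a z
  proof
    assume *: "of_real (r\<^sup>2) - cnj a * z = 0"
    have a: "a \<noteq> 0" using * r by auto
    hence "R \<le> r\<^sup>2 / cmod a" by (intro Rle) (use that in \<open>auto simp: T_def\<close>)
    hence "cmod a * R \<le> r\<^sup>2" using a by (simp add: field_simps)
    moreover have "cmod a * cmod z < cmod a * R"
      using that a by (intro mult_strict_left_mono) auto
    moreover from * have "cmod (of_real (r\<^sup>2)) = cmod (cnj a * z)" by simp
    hence "r\<^sup>2 = cmod a * cmod z" by (simp add: norm_mult norm_power)
    ultimately show False by simp
  qed
  obtain k where k: "k holomorphic_on ball 0 R" "\<And>z. z \<in> ball 0 R \<Longrightarrow> f z = exp (k z) * lin_prod ?Z (zmul f) z"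
  proof (rule exp_factorization[OF f entire_nz_lin_prod[OF fZ]])
    show "zmul f z = zmul (lin_prod ?Z (zmul f)) z" if "z \<in> ball 0 R" for z
      using zeros[of z] that zmul_eq_0_iff[OF f, of z] by (auto simp: zmul_lin_prod[OF fZ])
  qed (use R r in auto)
  \<comment> \<open>Dividing each denominator by \<open>r\<close> makes the powers of
    \<open>r\<close> on the two sides cancel. \<open>F\<close> is zero-free in the disc, so it only
    adds to the exponent.\<close>
  define F where "F = (\<lambda>z. \<Prod>a\<in>?Z. ((of_real (r\<^sup>2) - cnj a * z) / of_real r) ^ zmul f a)"
  have "F holomorphic_on ball 0 R"
    unfolding F_def using r by (intro holomorphic_intros) auto
  moreover have "F z \<noteq> 0" if "z \<in> ball 0 R" for z
    unfolding F_def using fZ nz[of _ z] that r by auto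
  moreover have "contractible (ball (0::complex) R)" by (simp add: convex_imp_contractible)
  ultimately obtain k2 where k2: "k2 holomorphic_on ball 0 R" "\<And>z. z \<in> ball 0 R \<Longrightarrow> F z = exp (k2 z)"
    using contractible_imp_holomorphic_log[of F "ball 0 R"] by metis
  show ?thesis
  proof (rule that[of R "\<lambda>z. k z + k2 z"])
    show "(\<lambda>z. k z + k2 z) holomorphic_on ball 0 R" by (intro holomorphic_intros k k2)
    fix z assume z: "cmod z < R"
    have 1: "(\<Prod>a\<in>?Z. (of_real (r\<^sup>2) - cnj a * z) ^ zmul f a) = (\<Prod>a\<in>?Z. of_real r ^ zmul f a) * F z"
      unfolding F_def prod.distrib[symmetric] power_mult_distrib[symmetric] using r by simp
    have 2: "(\<Prod>a\<in>?Z. (of_real r * (z - a)) ^ zmul f a) = (\<Prod>a\<in>?Z. of_real r ^ zmul f a) * lin_prod ?Z (zmul f) z"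
      unfolding lin_prod_def prod.distrib[symmetric] power_mult_distrib[symmetric] ..
    show "f z * (\<Prod>a\<in>?Z. (of_real (r\<^sup>2) - cnj a * z) ^ zmul f a) =
       exp (k z + k2 z) * (\<Prod>a\<in>?Z. (of_real r * (z - a)) ^ zmul f a)"
      unfolding 1 2 using k(2)[of z] k2(2)[of z] z by (simp add: exp_add)
  qed (use R in auto)
qed

lemma blaschke_denominator_nz:
  assumes "cmod a < r" "cmod z \<le> r"
  shows "of_real (r\<^sup>2) - cnj a * z \<noteq> 0"
proof
  assume "of_real (r\<^sup>2) - cnj a * z = 0"
  hence "cmod (of_real (r\<^sup>2)) = cmod (cnj a * z)" by simp
  hence "r\<^sup>2 = cmod a * cmod z" by (simp add: norm_mult norm_power)
  moreover have "cmod a * cmod z \<le> cmod a * r" by (intro mult_left_mono assms) auto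
  moreover have "cmod a * r < r * r"
    using assms by (intro mult_strict_right_mono) (auto intro: le_less_trans[OF norm_ge_zero])
  ultimately show False by (simp add: power2_eq_square)
qed

text \<open>Blaschke factors are unimodular on the circle, because there
  \<open>r^2 - cnj a * z = z * cnj (z - a)\<close>.\<close>

lemma cmod_blaschke_sphere:
  assumes "cmod z = r"
  shows "cmod (of_real (r\<^sup>2) - cnj a * z) = cmod (of_real r * (z - a))"
proof -
  have "of_real (r\<^sup>2) = z * cnj z" using assms complex_norm_square[of z] by simp
  hence "of_real (r\<^sup>2) - cnj a * z = z * cnj (z - a)" by (simp add: algebra_simps)
  thus ?thesis using assms by (auto simp: norm_mult simp del: complex_cnj_diff)
qed

lemma ln_blaschke:
  assumes f: "entire_nz f"
    and eq: "f z * (\<Prod>a\<in>zeros_in f r. (of_real (r\<^sup>2) - cnj a * z) ^ zmul f a) =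
       exp w * (\<Prod>a\<in>zeros_in f r. (of_real r * (z - a)) ^ zmul f a)"
    and z: "r > 0" "cmod z \<le> r" "f z \<noteq> 0"
  shows "ln (cmod (f z)) = Re w + (\<Sum>a\<in>zeros_in f r. real (zmul f a) *
           (ln (r * cmod (z - a)) - ln (cmod (of_real (r\<^sup>2) - cnj a * z))))"
proof -
  let ?Z = "zeros_in f r"
  have fZ: "finite ?Z" using f by (rule finite_zeros_in)
  have nz1: "of_real (r\<^sup>2) - cnj a * z \<noteq> 0" if "a \<in> ?Z" for a
    using blaschke_denominator_nz[of a r z] that z by (simp add: zeros_in_def)
  have nz2: "z - a \<noteq> 0" if "a \<in> ?Z" for a
    using that z by (auto simp: zeros_in_def)
  have "cmod (f z) * (\<Prod>a\<in>?Z. cmod (of_real (r\<^sup>2) - cnj a * z) ^ zmul f a) =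
       exp (Re w) * (\<Prod>a\<in>?Z. (r * cmod (z - a)) ^ zmul f a)"
    using arg_cong[OF eq, of cmod] z(1)
    by (simp only: norm_mult prod_norm[symmetric] norm_power norm_exp_eq_Re norm_of_real abs_of_pos)
  hence "ln (cmod (f z) * (\<Prod>a\<in>?Z. cmod (of_real (r\<^sup>2) - cnj a * z) ^ zmul f a)) =
       ln (exp (Re w) * (\<Prod>a\<in>?Z. (r * cmod (z - a)) ^ zmul f a))" by simp
  hence "ln (cmod (f z)) + (\<Sum>a\<in>?Z. zmul f a * ln (cmod (of_real (r\<^sup>2) - cnj a * z))) =
     Re w + (\<Sum>a\<in>?Z. zmul f a * ln (r * cmod (z - a)))"
    using z nz1 nz2 fZ
    by (subst (asm) (1 2) ln_mult_pos)
       (auto intro!: prod_pos simp: ln_prod ln_realpow simp del: of_real_power)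
  thus ?thesis by (simp add: sum_subtractf algebra_simps)
qed

text \<open>The Blaschke factors drop out on the circle, so the boundary values are those of the
  harmonic function \<open>Re \<kappa>\<close>, whatever zeros \<open>f\<close> has inside.\<close>

lemma ln_blaschke_sphere:
  assumes f: "entire_nz f"
    and eq: "f z * (\<Prod>a\<in>zeros_in f r. (of_real (r\<^sup>2) - cnj a * z) ^ zmul f a) =
       exp w * (\<Prod>a\<in>zeros_in f r. (of_real r * (z - a)) ^ zmul f a)"
    and z: "r > 0" "cmod z = r" "f z \<noteq> 0"
  shows "ln (cmod (f z)) = Re w"
  using ln_blaschke[OF f eq] cmod_blaschke_sphere[of z r] z by (simp add: norm_mult)

section \<open>Jensen's formula and the Nevanlinna characteristic\<close>

lemma sum_split_0:
  fixes h :: "complex \<Rightarrow> real"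
  assumes "finite S" "0 \<notin> S \<Longrightarrow> h 0 = 0"
  shows "(\<Sum>z\<in>S. h z) = h 0 + (\<Sum>z\<in>S - {0}. h z)"
  using assms by (cases "0 \<in> S") (simp_all add: sum.remove)

text \<open>The mean is \<open>Re (\<kappa> 0)\<close>, which the Blaschke identity at 0 expresses
  by the zeros. The constant is independent of \<open>r\<close>: it is the logarithm of the modulus
  of the first nonzero Taylor coefficient at 0.\<close>

lemma jensen:
  assumes f: "entire_nz f"
  obtains C where "\<And>r. r > 0 \<Longrightarrow> (\<And>z. cmod z = r \<Longrightarrow> f z \<noteq> 0) \<Longrightarrow>
    circ_mean (\<lambda>z. ln (cmod (f z))) r =
      C + zmul f 0 * ln r + (\<Sum>a\<in>zeros_in f r - {0}. zmul f a * (ln r - ln (cmod a)))"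
proof -
  let ?n = "zmul f 0"
  obtain u r0 where r0: "r0 > 0" "u holomorphic_on cball 0 r0"
    "\<And>w. w \<in> cball 0 r0 \<Longrightarrow> f w = u w * w ^ ?n \<and> u w \<noteq> 0"
  proof -
    have "connected (UNIV :: complex set)" by (simp add: Convex.connected_UNIV)
    hence "\<exists>r>0. zor_poly f 0 holomorphic_on cball 0 r \<and>
        (\<forall>w\<in>cball 0 r. f w = zor_poly f 0 w * w ^ nat (zorder f 0) \<and> zor_poly f 0 w \<noteq> 0)"
      using zorder_exist_zero[of f UNIV 0] f by (simp add: entire_nz_def)
    thus ?thesis using that[of _ "zor_poly f 0"] unfolding zmul_def by blast
  qed
  show ?thesis
  proof (rule that[of "ln (cmod (u 0))"])
    fix r :: real
    assume r: "r > 0" and gen: "\<And>z. cmod z = r \<Longrightarrow> f z \<noteq> 0"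
    let ?Z = "zeros_in f r"
    have fZ: "finite ?Z" using f by (rule finite_zeros_in)
    have n0: "?n = 0" if "0 \<notin> ?Z" using that r zmul_eq_0_iff[OF f, of 0] by (auto simp: zeros_in_def)
    have split: "(\<Prod>a\<in>?Z. h a ^ zmul f a) = h 0 ^ ?n * (\<Prod>a\<in>?Z - {0}. h a ^ zmul f a)"
      for h :: "complex \<Rightarrow> complex"
      using n0 by (cases "0 \<in> ?Z") (simp_all add: prod.remove[OF fZ])
    obtain R \<kappa> where \<kappa>: "R > r" "\<kappa> holomorphic_on ball 0 R"
      "\<And>z. cmod z < R \<Longrightarrow>
         f z * (\<Prod>a\<in>?Z. (of_real (r\<^sup>2) - cnj a * z) ^ zmul f a) =
         exp (\<kappa> z) * (\<Prod>a\<in>?Z. (of_real r * (z - a)) ^ zmul f a)"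
      using blaschke_factorization[OF f r gen] by blast
    have "circ_mean (\<lambda>z. ln (cmod (f z))) r = circ_mean (\<lambda>z. Re (\<kappa> z)) r"
      by (rule circ_mean_cong) (use r gen \<kappa> in \<open>auto intro!: ln_blaschke_sphere[OF f]\<close>)
    also have "\<dots> = Re (\<kappa> 0)" by (rule circ_mean_Re_holomorphic[OF \<kappa>(2) r \<kappa>(1)])
    finally have mean: "circ_mean (\<lambda>z. ln (cmod (f z))) r = Re (\<kappa> 0)" .
    \<comment> \<open>\<open>F\<close> and \<open>G\<close> are the two sides of the Blaschke
      identity divided by \<open>z ^ ?n\<close>. If \<open>f 0 = 0\<close>, that identity is void at
      0 itself, so \<open>F 0 = G 0\<close> is obtained as a limit.\<close>
    define F where "F = (\<lambda>z. u z * (\<Prod>a\<in>?Z. (of_real (r\<^sup>2) - cnj a * z) ^ zmul f a))"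
    define G where "G = (\<lambda>z. exp (\<kappa> z) * (of_real r ^ ?n * (\<Prod>a\<in>?Z - {0}. (of_real r * (z - a)) ^ zmul f a)))"
    define \<delta> where "\<delta> = min r0 R"
    have \<delta>: "\<delta> > 0" "\<delta> \<le> r0" "\<delta> \<le> R" using r0 \<kappa> r by (auto simp: \<delta>_def)
    have FG: "F z = G z" if "z \<in> ball 0 \<delta> - {0}" for z
    proof -
      have "z ^ ?n * F z = f z * (\<Prod>a\<in>?Z. (of_real (r\<^sup>2) - cnj a * z) ^ zmul f a)"
        using r0(3)[of z] that \<delta> by (simp add: F_def)
      also have "\<dots> = exp (\<kappa> z) * (\<Prod>a\<in>?Z. (of_real r * (z - a)) ^ zmul f a)"
        using \<kappa>(3)[of z] that \<delta> by simp
      also have "\<dots> = z ^ ?n * G z"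
        by (subst split) (simp add: G_def power_mult_distrib)
      finally show ?thesis using that by simp
    qed
    have "F holomorphic_on ball 0 \<delta>" "G holomorphic_on ball 0 \<delta>"
      unfolding F_def G_def using \<delta>
      by (auto intro!: holomorphic_intros holomorphic_on_subset[OF r0(2)] holomorphic_on_subset[OF \<kappa>(2)])
    hence "isCont F 0" "isCont G 0"
      using \<delta> by (auto intro!: continuous_on_interior[of "ball 0 \<delta>"] holomorphic_on_imp_continuous_on)
    hence lim: "F \<midarrow>0\<rightarrow> F 0" "G \<midarrow>0\<rightarrow> G 0" by (auto simp: isCont_def)
    have "\<forall>\<^sub>F z in at 0. F z = G z"
      unfolding eventually_at using FG \<delta> by (intro exI[of _ \<delta>]) auto
    hence "G \<midarrow>0\<rightarrow> F 0" by (rule Lim_transform_eventually[OF lim(1)])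
    hence "F 0 = G 0" by (rule LIM_unique) (rule lim(2))
    hence "cmod (F 0) = cmod (G 0)" by simp
    hence "cmod (u 0) * ((r\<^sup>2) ^ ?n * (\<Prod>a\<in>?Z - {0}. (r\<^sup>2) ^ zmul f a)) =
           exp (Re (\<kappa> 0)) * (r ^ ?n * (\<Prod>a\<in>?Z - {0}. (r * cmod a) ^ zmul f a))"
      unfolding F_def G_def split using r
      by (simp add: norm_mult norm_power prod_norm[symmetric])
    hence eq: "ln (cmod (u 0) * ((r\<^sup>2) ^ ?n * (\<Prod>a\<in>?Z - {0}. (r\<^sup>2) ^ zmul f a))) =
           ln (exp (Re (\<kappa> 0)) * (r ^ ?n * (\<Prod>a\<in>?Z - {0}. (r * cmod a) ^ zmul f a)))" by simp
    have u0: "cmod (u 0) > 0" using r0 by auto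
    have P1: "(\<Prod>a\<in>?Z - {0}. (r\<^sup>2) ^ zmul f a) > 0" using r by (intro prod_pos) auto
    have P2: "(\<Prod>a\<in>?Z - {0}. (r * cmod a) ^ zmul f a) > 0" using r by (intro prod_pos) auto
    have L1: "ln (\<Prod>a\<in>?Z - {0}. (r\<^sup>2) ^ zmul f a) = (\<Sum>a\<in>?Z - {0}. zmul f a * (2 * ln r))"
      using r fZ by (subst ln_prod) (auto simp: ln_realpow intro!: sum.cong)
    have L2: "ln (\<Prod>a\<in>?Z - {0}. (r * cmod a) ^ zmul f a) = (\<Sum>a\<in>?Z - {0}. zmul f a * (ln r + ln (cmod a)))"
      using r fZ by (subst ln_prod) (auto simp: ln_realpow ln_mult_pos intro!: sum.cong)
    have "ln (cmod (u 0) * ((r\<^sup>2) ^ ?n * (\<Prod>a\<in>?Z - {0}. (r\<^sup>2) ^ zmul f a))) =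
        ln (cmod (u 0)) + (?n * (2 * ln r) + (\<Sum>a\<in>?Z - {0}. zmul f a * (2 * ln r)))"
      using P1 r u0 by (subst ln_mult_pos; (subst ln_mult_pos)?) (auto simp: L1 ln_realpow)
    moreover have "ln (exp (Re (\<kappa> 0)) * (r ^ ?n * (\<Prod>a\<in>?Z - {0}. (r * cmod a) ^ zmul f a))) =
        Re (\<kappa> 0) + (?n * ln r + (\<Sum>a\<in>?Z - {0}. zmul f a * (ln r + ln (cmod a))))"
      using P2 r by (subst ln_mult_pos; (subst ln_mult_pos)?) (auto simp: L2 ln_realpow)
    ultimately have "ln (cmod (u 0)) + (?n * (2 * ln r) + (\<Sum>a\<in>?Z - {0}. zmul f a * (2 * ln r))) =
           Re (\<kappa> 0) + (?n * ln r + (\<Sum>a\<in>?Z - {0}. zmul f a * (ln r + ln (cmod a))))"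
      using eq by simp
    hence "Re (\<kappa> 0) = ln (cmod (u 0)) + ?n * ln r + ((\<Sum>a\<in>?Z - {0}. zmul f a * (2 * ln r)) -
        (\<Sum>a\<in>?Z - {0}. zmul f a * (ln r + ln (cmod a))))"
      by linarith
    also have "(\<Sum>a\<in>?Z - {0}. zmul f a * (2 * ln r)) - (\<Sum>a\<in>?Z - {0}. zmul f a * (ln r + ln (cmod a))) =
        (\<Sum>a\<in>?Z - {0}. zmul f a * (ln r - ln (cmod a)))"
      unfolding sum_subtractf[symmetric] by (intro sum.cong) (auto simp: algebra_simps)
    finally have "Re (\<kappa> 0) = ln (cmod (u 0)) + ?n * ln r + (\<Sum>a\<in>?Z - {0}. zmul f a * (ln r - ln (cmod a)))" .
    thus "circ_mean (\<lambda>z. ln (cmod (f z))) r =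
      ln (cmod (u 0)) + ?n * ln r + (\<Sum>a\<in>?Z - {0}. zmul f a * (ln r - ln (cmod a)))"
      using mean by simp
  qed
qed

text \<open>A representation in lowest terms. At a pole \<open>A z / B z\<close> is a division by 0,
  hence 0, which agrees with the dummy value of \<open>g\<close>.\<close>

definition mero_rep :: "(complex \<Rightarrow> complex) \<Rightarrow> (complex \<Rightarrow> complex) \<Rightarrow> (complex \<Rightarrow> complex) \<Rightarrow> bool" where
  "mero_rep g A B \<longleftrightarrow> A holomorphic_on UNIV \<and> entire_nz B \<and> (\<forall>z. A z = 0 \<longrightarrow> B z \<noteq> 0) \<and>
     (\<forall>z. g z = A z / B z) \<and> (\<forall>z. is_pole g z \<longleftrightarrow> B z = 0) \<and>
     (\<forall>z. is_pole g z \<longrightarrow> zorder g z = - zorder B z)"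

lemma pole_count_mero_rep:
  assumes "mero_rep g A B"
  shows "pole_count g t = (\<Sum>z | cmod z \<le> t \<and> B z = 0. zmul B z)"
  unfolding pole_count_def
  by (rule sum.cong) (use assms in \<open>auto simp: mero_rep_def pole_mult_def zmul_def\<close>)

lemma has_integral_inverse_from:
  assumes "0 < p" "p \<le> (r::real)"
  shows "((\<lambda>t. if p \<le> t then 1 / t else 0) has_integral (ln r - ln p)) {0..r}"
proof -
  have "((\<lambda>t. 1 / t) has_integral (ln r - ln p)) {p..r}"
    by (rule fundamental_theorem_of_calculus)
       (use assms in \<open>auto intro!: derivative_eq_intros simp: has_real_derivative_iff_has_vector_derivative[symmetric]\<close>)
  hence "((\<lambda>t. if t \<in> {p..r} then 1 / t else 0) has_integral (ln r - ln p)) {0..r}"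
    by (subst has_integral_restrict) (use assms in auto)
  thus ?thesis
    by (rule has_integral_eq[rotated]) auto
qed

text \<open>The integrand is a finite sum of step functions over \<open>t\<close>, one for each
  pole, integrated termwise. A pole at 0 enters through the logarithmic term alone.\<close>

lemma nevanlinna_N_mero_rep:
  assumes g: "mero_rep g A B" and r: "r > 0"
  shows "nevanlinna_N g r =
    (\<Sum>p | cmod p \<le> r \<and> B p = 0 \<and> p \<noteq> 0. zmul B p * (ln r - ln (cmod p))) + zmul B 0 * ln r"
proof -
  have B: "entire_nz B" using g by (simp add: mero_rep_def)
  let ?P = "{p. cmod p \<le> r \<and> B p = 0 \<and> p \<noteq> 0}"
  have fP: "finite ?P" by (rule finite_subset[OF _ finite_zeros_cball[OF B, of r]]) auto
  have c0: "pole_count g 0 = zmul B 0"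
  proof (cases "B 0 = 0")
    case True
    hence "{z. cmod z \<le> 0 \<and> B z = 0} = {0}" by auto
    thus ?thesis using pole_count_mero_rep[OF g, of 0] by simp
  next
    case False
    hence "{z. cmod z \<le> 0 \<and> B z = 0} = {}" by auto
    thus ?thesis using pole_count_mero_rep[OF g, of 0] False zmul_eq_0_iff[OF B, of 0] by simp
  qed
  have ct: "real (pole_count g t) - real (pole_count g 0) =
      (\<Sum>p\<in>?P. real (zmul B p) * (if cmod p \<le> t then 1 else 0))" if "t \<in> {0..r}" for t
  proof -
    let ?Q = "{z. cmod z \<le> t \<and> B z = 0}"
    have fQ: "finite ?Q" by (rule finite_zeros_cball[OF B])
    have "real (pole_count g t) = (\<Sum>z\<in>?Q. real (zmul B z))"
      by (simp add: pole_count_mero_rep[OF g])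
    also have "\<dots> = real (zmul B 0) + (\<Sum>z\<in>?Q - {0}. real (zmul B z))"
      using that zmul_eq_0_iff[OF B, of 0] by (intro sum_split_0 fQ) auto
    also have "(\<Sum>z\<in>?Q - {0}. real (zmul B z)) = (\<Sum>p\<in>?P. real (zmul B p) * (if cmod p \<le> t then 1 else 0))"
      by (rule sum.mono_neutral_cong_left) (use that fP in auto)
    finally show ?thesis by (simp add: c0)
  qed
  have "((\<lambda>t. \<Sum>p\<in>?P. real (zmul B p) * (if cmod p \<le> t then 1 / t else 0)) has_integral
          (\<Sum>p\<in>?P. real (zmul B p) * (ln r - ln (cmod p)))) {0..r}"
    by (intro has_integral_sum fP has_integral_mult_right has_integral_inverse_from) auto
  hence "((\<lambda>t. (real (pole_count g t) - real (pole_count g 0)) / t) has_integral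
          (\<Sum>p\<in>?P. real (zmul B p) * (ln r - ln (cmod p)))) {0..r}"
    by (rule has_integral_eq[rotated])
       (auto simp: ct sum_divide_distrib intro!: sum.cong)
  thus ?thesis unfolding nevanlinna_N_def c0 by (simp add: integral_unique)
qed

section \<open>Growth and zeros of the linear forms\<close>

lemma continuous_on_ln_cmod:
  assumes "continuous_on S f" "\<And>z. z \<in> S \<Longrightarrow> f z \<noteq> 0"
  shows "continuous_on S (\<lambda>z. ln (cmod (f z)))"
  by (intro continuous_intros assms) (use assms(2) in auto)

lemma log_plus_nonneg: "log_plus x \<ge> 0"
  by (simp add: log_plus_def)

lemma continuous_on_log_plus [continuous_intros]:
  "continuous_on S f \<Longrightarrow> continuous_on S (\<lambda>x. log_plus (f x))"
  unfolding log_plus_def by (intro continuous_intros) auto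

text \<open>Both sides are \<open>log_plus x + log_plus (1 / x)\<close>. Thus an upper bound for
  \<open>log_plus x\<close> and a lower bound for \<open>ln x\<close> bound the absolute
  value.\<close>

lemma abs_ln_eq_log_plus: "x > 0 \<Longrightarrow> \<bar>ln x\<bar> = 2 * log_plus x - ln x"
  by (cases "x \<ge> 1") (auto simp: log_plus_def max_def)

lemma log_plus_diff_le: "log_plus (cmod (x - y)) \<le> log_plus (cmod x) + log_plus (cmod y) + ln 2"
proof -
  have "cmod (x - y) \<le> cmod x + cmod y" by (rule norm_triangle_ineq4)
  also have "\<dots> \<le> max 1 (cmod x) * max 1 (cmod y) + max 1 (cmod x) * max 1 (cmod y)"
    using mult_mono[of "cmod x" "max 1 (cmod x)" 1 "max 1 (cmod y)"]
      mult_mono[of 1 "max 1 (cmod x)" "cmod y" "max 1 (cmod y)"]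
    by (intro add_mono) auto
  finally have "cmod (x - y) \<le> 2 * (max 1 (cmod x) * max 1 (cmod y))" by simp
  moreover have "1 \<le> max 1 (cmod x) * max 1 (cmod y)"
    using mult_mono[of 1 "max 1 (cmod x)" 1 "max 1 (cmod y)"] by simp
  ultimately have "max 1 (cmod (x - y)) \<le> max 1 (cmod x) * max 1 (cmod y) * 2" by simp
  hence "ln (max 1 (cmod (x - y))) \<le> ln (max 1 (cmod x) * max 1 (cmod y) * 2)"
    by simp
  also have "\<dots> = log_plus (cmod x) + log_plus (cmod y) + ln 2"
    unfolding log_plus_def by (subst ln_mult_pos; (subst ln_mult_pos)?) (auto simp: less_max_iff_disj)
  finally show ?thesis by (simp add: log_plus_def)
qed

text \<open>
  For \<open>g = A / B\<close> in lowest terms, the zeros of the form are, with multiplicity, the points where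
  \<open>g\<close> takes the value.
\<close>

fun lform :: "(complex \<Rightarrow> complex) \<Rightarrow> (complex \<Rightarrow> complex) \<Rightarrow> complex option \<Rightarrow> complex \<Rightarrow> complex" where
  "lform A B (Some a) z = A z - a * B z"
| "lform A B None z = B z"

text \<open>In Jensen's formula all terms beyond the constant are nonnegative for
  \<open>r \<ge> 1\<close>. At radius \<open>2 * r\<close> each zero in the disc of radius
  \<open>r\<close> contributes at least \<open>ln 2\<close>, which turns a growth bound into a zero
  count.\<close>

lemma jensen_lower_bound:
  assumes "entire_nz f"
  shows "\<exists>C. (\<forall>r\<ge>1. (\<forall>z. cmod z = r \<longrightarrow> f z \<noteq> 0) \<longrightarrow>
        C \<le> circ_mean (\<lambda>z. ln (cmod (f z))) r) \<and>
    (\<forall>r\<ge>2. (\<forall>z. cmod z = 2 * r \<longrightarrow> f z \<noteq> 0) \<longrightarrow>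
        C + ln 2 * (\<Sum>a\<in>zeros_in f r. real (zmul f a)) \<le> circ_mean (\<lambda>z. ln (cmod (f z))) (2 * r))"
proof -
  obtain C where C: "\<And>r. r > 0 \<Longrightarrow> (\<And>z. cmod z = r \<Longrightarrow> f z \<noteq> 0) \<Longrightarrow>
    circ_mean (\<lambda>z. ln (cmod (f z))) r =
      C + zmul f 0 * ln r + (\<Sum>a\<in>zeros_in f r - {0}. zmul f a * (ln r - ln (cmod a)))"
    using jensen[OF assms] by blast
  show ?thesis
  proof (intro exI[of _ C] conjI allI impI)
    fix r :: real assume r: "r \<ge> 1" "\<forall>z. cmod z = r \<longrightarrow> f z \<noteq> 0"
    have "0 \<le> zmul f 0 * ln r" using r by simp
    moreover have "0 \<le> (\<Sum>a\<in>zeros_in f r - {0}. zmul f a * (ln r - ln (cmod a)))"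
      using r by (intro sum_nonneg mult_nonneg_nonneg) (auto simp: zeros_in_def)
    ultimately show "C \<le> circ_mean (\<lambda>z. ln (cmod (f z))) r" using C[of r] r by simp
  next
    fix r :: real assume r: "r \<ge> 2" "\<forall>z. cmod z = 2 * r \<longrightarrow> f z \<noteq> 0"
    let ?Z = "zeros_in f r"
    have fZ: "finite ?Z" "finite (zeros_in f (2 * r))" using assms by (auto intro: finite_zeros_in)
    have ln2: "ln 2 \<le> ln (2 * r)" using r by simp
    have "ln 2 * (\<Sum>a\<in>?Z. real (zmul f a)) = ln 2 * zmul f 0 + (\<Sum>a\<in>?Z - {0}. zmul f a * ln 2)"
      using zmul_eq_0_iff[OF assms, of 0] r
      by (subst sum_split_0[OF fZ(1)]) (auto simp: zeros_in_def sum_distrib_left algebra_simps)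
    also have "\<dots> \<le> zmul f 0 * ln (2 * r) + (\<Sum>a\<in>?Z - {0}. zmul f a * (ln (2 * r) - ln (cmod a)))"
    proof (intro add_mono sum_mono mult_left_mono)
      show "ln 2 * real (zmul f 0) \<le> real (zmul f 0) * ln (2 * r)"
        using mult_left_mono[OF ln2, of "real (zmul f 0)"] by (simp add: mult.commute)
      fix a assume a: "a \<in> ?Z - {0}"
      hence "cmod a \<le> r" "cmod a > 0" by (auto simp: zeros_in_def)
      hence "ln 2 + ln (cmod a) \<le> ln 2 + ln r" using r by simp
      also have "\<dots> = ln (2 * r)" using r by (simp add: ln_mult_pos)
      finally show "ln 2 \<le> ln (2 * r) - ln (cmod a)" by simp
    qed auto
    also have "\<dots> \<le> zmul f 0 * ln (2 * r) + (\<Sum>a\<in>zeros_in f (2 * r) - {0}. zmul f a * (ln (2 * r) - ln (cmod a)))"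
      using fZ r by (intro add_left_mono sum_mono2 mult_nonneg_nonneg) (auto simp: zeros_in_def)
    finally show "C + ln 2 * (\<Sum>a\<in>zeros_in f r. real (zmul f a)) \<le> circ_mean (\<lambda>z. ln (cmod (f z))) (2 * r)"
      using C[of "2 * r"] r by simp
  qed
qed

text \<open>Jensen's formula for \<open>B\<close>, whose zeros are the poles of
  \<open>g\<close>.\<close>

lemma nevanlinna_N_eq_mean:
  assumes g: "mero_rep g A B"
  obtains C where "\<And>r. r > 0 \<Longrightarrow> (\<And>z. cmod z = r \<Longrightarrow> B z \<noteq> 0) \<Longrightarrow>
      circ_mean (\<lambda>z. ln (cmod (B z))) r = C + nevanlinna_N g r"
proof -
  have B: "entire_nz B" using g by (simp add: mero_rep_def)
  obtain C where C: "\<And>r. r > 0 \<Longrightarrow> (\<And>z. cmod z = r \<Longrightarrow> B z \<noteq> 0) \<Longrightarrow>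
    circ_mean (\<lambda>z. ln (cmod (B z))) r =
      C + zmul B 0 * ln r + (\<Sum>a\<in>zeros_in B r - {0}. zmul B a * (ln r - ln (cmod a)))"
    using jensen[OF B] by blast
  show ?thesis
  proof (rule that[of C])
    fix r :: real assume r: "r > 0" "\<And>z. cmod z = r \<Longrightarrow> B z \<noteq> 0"
    have "{p. cmod p \<le> r \<and> B p = 0 \<and> p \<noteq> 0} = zeros_in B r - {0}"
      using r(2) by (force simp: zeros_in_def)
    thus "circ_mean (\<lambda>z. ln (cmod (B z))) r = C + nevanlinna_N g r"
      using C[OF r] nevanlinna_N_mero_rep[OF g r(1)] by simp
  qed
qed

lemma nevanlinna_N_nonneg:
  assumes "mero_rep g A B" "r \<ge> 1"
  shows "nevanlinna_N g r \<ge> 0"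
proof -
  have "0 \<le> (\<Sum>p | cmod p \<le> r \<and> B p = 0 \<and> p \<noteq> 0. zmul B p * (ln r - ln (cmod p)))"
    using assms by (intro sum_nonneg mult_nonneg_nonneg) auto
  thus ?thesis using nevanlinna_N_mero_rep[OF assms(1), of r] assms(2) by simp
qed

text \<open>The quotient of the form by \<open>B\<close> is \<open>g - a\<close>, or 1 for the value
  infinity. By \<open>abs_ln_eq_log_plus\<close> it suffices to bound the means of
  \<open>log_plus (cmod (g z))\<close> and \<open>ln (cmod (B z))\<close> above, by
  \<open>nevanlinna_T\<close>, and that of \<open>ln\<close> of the form below, by Jensen's
  formula.\<close>

lemma lform_growth:
  assumes g: "mero_rep g A B" and l: "entire_nz (lform A B v)"
    and T: "\<forall>\<^sub>F r in at_top. nevanlinna_T g r \<le> sqrt r"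
  shows "\<exists>K r0. \<forall>r\<ge>r0. (\<forall>z. cmod z = r \<longrightarrow> B z \<noteq> 0 \<and> lform A B v z \<noteq> 0) \<longrightarrow>
     circ_mean (\<lambda>z. \<bar>ln (cmod (lform A B v z)) - ln (cmod (B z))\<bar>) r \<le> K * sqrt r \<and>
     circ_mean (\<lambda>z. ln (cmod (lform A B v z))) r \<le> K * sqrt r"
proof -
  have B: "entire_nz B" using g by (simp add: mero_rep_def)
  obtain r1 where r1: "\<And>r. r \<ge> r1 \<Longrightarrow> nevanlinna_T g r \<le> sqrt r"
    using T by (auto simp: eventually_at_top_linorder)
  obtain C1 where C1: "\<And>r. r > 0 \<Longrightarrow> (\<And>z. cmod z = r \<Longrightarrow> B z \<noteq> 0) \<Longrightarrow>
      circ_mean (\<lambda>z. ln (cmod (B z))) r = C1 + nevanlinna_N g r"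
    using nevanlinna_N_eq_mean[OF g] by blast
  obtain C2 where C2: "\<And>r. r \<ge> 1 \<Longrightarrow> (\<And>z. cmod z = r \<Longrightarrow> lform A B v z \<noteq> 0) \<Longrightarrow>
      C2 \<le> circ_mean (\<lambda>z. ln (cmod (lform A B v z))) r"
    using jensen_lower_bound[OF l] by metis
  \<comment> \<open>Together with \<open>ln 2\<close>, the loss in passing from \<open>g\<close> to
    \<open>g - a\<close>; for infinity \<open>la\<close> is 0.\<close>
  define la where "la = log_plus (case v of None \<Rightarrow> 0 | Some a \<Rightarrow> cmod a)"
  define C3 where "C3 = 2 * (la + ln 2) - C2 + C1"
  let ?l = "lform A B v" and ?K = "4 + \<bar>C3\<bar> + \<bar>C1\<bar>"
  have *: "circ_mean (\<lambda>z. \<bar>ln (cmod (?l z)) - ln (cmod (B z))\<bar>) r \<le> ?K * sqrt r \<and>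
      circ_mean (\<lambda>z. ln (cmod (?l z))) r \<le> ?K * sqrt r"
    if r: "max 1 r1 \<le> r" and gen: "\<And>z. cmod z = r \<Longrightarrow> B z \<noteq> 0 \<and> ?l z \<noteq> 0" for r
  proof -
    have s1: "sqrt r \<ge> 1" using r by simp
    have cB: "continuous_on (sphere 0 r) (\<lambda>z. ln (cmod (B z)))"
      by (rule continuous_on_ln_cmod[OF entire_nz_continuous[OF B]]) (use gen in auto)
    have cl: "continuous_on (sphere 0 r) (\<lambda>z. ln (cmod (?l z)))"
      by (rule continuous_on_ln_cmod[OF entire_nz_continuous[OF l]]) (use gen in auto)
    have cg: "continuous_on (sphere 0 r) (\<lambda>z. log_plus (cmod (g z)))"
    proof -
      have "continuous_on (sphere 0 r) (\<lambda>z. A z / B z)"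
        using g gen unfolding mero_rep_def
        by (intro continuous_on_divide holomorphic_on_imp_continuous_on)
           (auto intro: holomorphic_on_subset entire_nz_holomorphic)
      moreover have "g = (\<lambda>z. A z / B z)" using g by (auto simp: mero_rep_def)
      ultimately show ?thesis by (intro continuous_intros) simp
    qed
    define m where "m = circ_mean (\<lambda>z. log_plus (cmod (g z))) r"
    have m0: "m \<ge> 0"
      using circ_mean_mono[OF _ cg, of "\<lambda>_. 0"] r log_plus_nonneg by (simp add: m_def circ_mean_const)
    have N0: "nevanlinna_N g r \<ge> 0" using nevanlinna_N_nonneg[OF g] r by simp
    have mN: "m + nevanlinna_N g r \<le> sqrt r"
      using r1[of r] r by (simp add: nevanlinna_T_def nevanlinna_m_eq_circ_mean m_def)
    have mB: "circ_mean (\<lambda>z. ln (cmod (B z))) r = C1 + nevanlinna_N g r"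
      by (rule C1) (use r gen in auto)
    have ml: "C2 \<le> circ_mean (\<lambda>z. ln (cmod (?l z))) r"
      by (rule C2) (use r gen in auto)
    have pt: "\<bar>ln (cmod (?l z)) - ln (cmod (B z))\<bar> \<le>
       (2 * log_plus (cmod (g z)) + 2 * (la + ln 2)) + (ln (cmod (B z)) + (-1) * ln (cmod (?l z)))"
      if z: "cmod z = r" for z
    proof (cases v)
      case None
      thus ?thesis using log_plus_nonneg by (simp add: la_def)
    next
      case (Some a)
      have Bz: "B z \<noteq> 0" and lz: "?l z \<noteq> 0" using gen[OF z] by auto
      have "?l z / B z = g z - a"
        using g Bz by (simp add: Some mero_rep_def field_simps)
      moreover have "ln (cmod (?l z)) - ln (cmod (B z)) = ln (cmod (?l z / B z))"
        using Bz lz by (simp add: norm_divide ln_div)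
      moreover have "\<bar>ln (cmod (?l z / B z))\<bar> = 2 * log_plus (cmod (?l z / B z)) - ln (cmod (?l z / B z))"
        using Bz lz by (intro abs_ln_eq_log_plus) simp
      moreover have "log_plus (cmod (g z - a)) \<le> log_plus (cmod (g z)) + la + ln 2"
        using log_plus_diff_le[of "g z" a] by (simp add: la_def Some)
      ultimately show ?thesis by simp
    qed
    let ?u = "\<lambda>z. \<bar>ln (cmod (?l z)) - ln (cmod (B z))\<bar>"
    have cu: "continuous_on (sphere 0 r) ?u" by (intro continuous_intros cl cB)
    have "circ_mean ?u r \<le> circ_mean (\<lambda>z. (2 * log_plus (cmod (g z)) + 2 * (la + ln 2)) +
        (ln (cmod (B z)) + (-1) * ln (cmod (?l z)))) r"
      by (rule circ_mean_mono[OF cu _ _ pt]) (use r in \<open>auto intro!: continuous_intros cg cB cl\<close>)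
    also have "\<dots> = (2 * m + 2 * (la + ln 2)) + ((C1 + nevanlinna_N g r) + (-1) * circ_mean (\<lambda>z. ln (cmod (?l z))) r)"
    proof -
      have r0: "r \<ge> 0" using r by simp
      have c1: "continuous_on (sphere 0 r) (\<lambda>z. 2 * log_plus (cmod (g z)))"
        by (intro continuous_on_mult continuous_on_const cg)
      have c2: "continuous_on (sphere 0 r) (\<lambda>z. (-1) * ln (cmod (?l z)))"
        by (intro continuous_on_mult continuous_on_const cl)
      show ?thesis
        unfolding circ_mean_add[OF continuous_on_add[OF c1 continuous_on_const] continuous_on_add[OF cB c2] r0]
          circ_mean_add[OF c1 continuous_on_const r0] circ_mean_add[OF cB c2 r0]
          circ_mean_cmult circ_mean_const m_def mB ..
    qed
    also have "\<dots> \<le> 3 * sqrt r + C3"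
      using ml mN m0 N0 by (simp add: C3_def)
    finally have 1: "circ_mean ?u r \<le> 3 * sqrt r + C3" .
    have C3: "C3 \<le> \<bar>C3\<bar> * sqrt r" using mult_left_mono[OF s1, of "\<bar>C3\<bar>"] by simp
    have C1': "C1 \<le> \<bar>C1\<bar> * sqrt r" using mult_left_mono[OF s1, of "\<bar>C1\<bar>"] by simp
    have "circ_mean (\<lambda>z. ln (cmod (?l z))) r \<le> circ_mean (\<lambda>z. ?u z + ln (cmod (B z))) r"
      by (intro circ_mean_mono cl continuous_intros cB) (use r in auto)
    also have "\<dots> = circ_mean ?u r + (C1 + nevanlinna_N g r)"
      by (subst circ_mean_add[OF cu cB]) (use r mB in auto)
    finally have 2: "circ_mean (\<lambda>z. ln (cmod (?l z))) r \<le> circ_mean ?u r + (C1 + nevanlinna_N g r)" .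
    have C1'': "0 \<le> \<bar>C1\<bar> * sqrt r" using s1 by simp
    show "circ_mean ?u r \<le> (4 + \<bar>C3\<bar> + \<bar>C1\<bar>) * sqrt r \<and>
        circ_mean (\<lambda>z. ln (cmod (?l z))) r \<le> (4 + \<bar>C3\<bar> + \<bar>C1\<bar>) * sqrt r"
    proof -
      have "?K * sqrt r = 4 * sqrt r + \<bar>C3\<bar> * sqrt r + \<bar>C1\<bar> * sqrt r" by (simp add: distrib_right)
      thus ?thesis using 1 2 C3 C1' C1'' mN m0 s1 by linarith
    qed
  qed
  show ?thesis
    by (rule exI[of _ ?K], rule exI[of _ "max 1 r1"]) (use * in blast)
qed

text \<open>Jensen's lower bound at radius \<open>2 * r\<close> is played against
  \<open>lform_growth\<close> there, hence the condition on the larger circle.\<close>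

lemma lform_zero_count:
  assumes g: "mero_rep g A B" and l: "entire_nz (lform A B v)"
    and T: "\<forall>\<^sub>F r in at_top. nevanlinna_T g r \<le> sqrt r"
  shows "\<exists>K r0. \<forall>r\<ge>r0. (\<forall>z. cmod z = 2 * r \<longrightarrow> B z \<noteq> 0 \<and> lform A B v z \<noteq> 0) \<longrightarrow>
     (\<Sum>a\<in>zeros_in (lform A B v) r. real (zmul (lform A B v) a)) \<le> K * sqrt r"
proof -
  obtain K r0 where K: "\<And>r. r \<ge> r0 \<Longrightarrow> (\<And>z. cmod z = r \<Longrightarrow> B z \<noteq> 0 \<and> lform A B v z \<noteq> 0) \<Longrightarrow>
     circ_mean (\<lambda>z. ln (cmod (lform A B v z))) r \<le> K * sqrt r"
    using lform_growth[OF assms] by metis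
  obtain C where C: "\<And>r. r \<ge> 2 \<Longrightarrow> (\<And>z. cmod z = 2 * r \<Longrightarrow> lform A B v z \<noteq> 0) \<Longrightarrow>
      C + ln 2 * (\<Sum>a\<in>zeros_in (lform A B v) r. real (zmul (lform A B v) a)) \<le>
        circ_mean (\<lambda>z. ln (cmod (lform A B v z))) (2 * r)"
    using jensen_lower_bound[OF l] by metis
  show ?thesis
  proof (rule exI[of _ "(2 * \<bar>K\<bar> + \<bar>C\<bar>) / ln 2"], rule exI[of _ "max 2 r0"], intro allI impI)
    fix r assume r: "max 2 r0 \<le> r" and gen: "\<forall>z. cmod z = 2 * r \<longrightarrow> B z \<noteq> 0 \<and> lform A B v z \<noteq> 0"
    let ?S = "\<Sum>a\<in>zeros_in (lform A B v) r. real (zmul (lform A B v) a)"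
    have s1: "sqrt r \<ge> 1" using r by simp
    have "C + ln 2 * ?S \<le> circ_mean (\<lambda>z. ln (cmod (lform A B v z))) (2 * r)"
      by (rule C) (use r gen in auto)
    also have "\<dots> \<le> K * sqrt (2 * r)"
      by (rule K) (use r gen in auto)
    also have "\<dots> \<le> \<bar>K\<bar> * (2 * sqrt r)"
    proof (rule mult_mono)
      show "sqrt (2 * r) \<le> 2 * sqrt r"
        using r sqrt2_less_2 by (simp add: real_sqrt_mult mult_right_mono)
    qed (use r in auto)
    finally have "ln 2 * ?S \<le> \<bar>K\<bar> * (2 * sqrt r) - C" by simp
    also have "\<dots> \<le> (2 * \<bar>K\<bar> + \<bar>C\<bar>) * sqrt r"
      using mult_left_mono[OF s1, of "\<bar>C\<bar>"] by (simp add: algebra_simps)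
    finally show "?S \<le> (2 * \<bar>K\<bar> + \<bar>C\<bar>) / ln 2 * sqrt r" by (simp add: field_simps)
  qed
qed

section \<open>Multiplicities along the orbits of an affine contraction\<close>

text \<open>Zero order allows any positive power of \<open>r\<close> as an eventual bound. The power
  1/2 leaves room for a further factor \<open>ln r\<close> below linear growth.\<close>

lemma order_0_imp_T_le_sqrt:
  assumes "mero_order g = 0"
  shows "\<forall>\<^sub>F r in at_top. nevanlinna_T g r \<le> sqrt r"
proof -
  have "Limsup at_top (\<lambda>r. ereal (log_plus (nevanlinna_T g r) / ln r)) < ereal (1 / 2)"
    using assms by (simp add: mero_order_def)
  hence "\<forall>\<^sub>F r in at_top. ereal (log_plus (nevanlinna_T g r) / ln r) < ereal (1 / 2)"
    by (rule Limsup_lessD)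
  thus ?thesis
    using eventually_gt_at_top[of 1]
  proof eventually_elim
    case (elim r)
    hence "log_plus (nevanlinna_T g r) \<le> ln r / 2" by (simp add: field_simps)
    also have "\<dots> = ln (sqrt r)" using elim by (simp add: ln_sqrt)
    finally have "max 1 (nevanlinna_T g r) \<le> sqrt r"
      unfolding log_plus_def using elim by (subst (asm) ln_le_cancel_iff) auto
    thus ?case by simp
  qed
qed

text \<open>
  Outside \<open>E\<close> the multiplicity can only grow along forward orbits, which converge to the fixed
  point; so every orbit of positive multiplicity meets \<open>E\<close>, and along the finitely many backward
  orbits of \<open>E\<close> the multiplicities are eventually decreasing, hence eventually constant.
\<close>

lemma finite_not_invariant:
  fixes d :: "complex \<Rightarrow> nat"
  assumes q: "0 < cmod q" "cmod q < 1"
    and fin: "\<And>r. finite {z. cmod z \<le> r \<and> d z > 0}"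
    and E: "finite E" and mono: "\<And>z. z \<notin> E \<Longrightarrow> d z \<le> d (q * z + c)"
  shows "finite {z. d z \<noteq> d (q * z + c)}"
proof -
  define p where "p = c / (1 - q)"
  have q1: "1 - q \<noteq> 0" "q \<noteq> 0" using q by auto
  have p: "q * p + c = p" using q1 by (simp add: p_def field_simps)
  \<comment> \<open>\<open>orb k\<close> is the k-th iterate of the affine map and
    \<open>bor k\<close> that of its inverse, written around the fixed point
    \<open>p\<close>.\<close>
  define orb where "orb = (\<lambda>k z. p + q ^ k * (z - p))"
  define bor where "bor = (\<lambda>k e. p + (e - p) / q ^ k)"
  have L: "q * z + c = p + q * (z - p)" for z using p by (simp add: algebra_simps)
  have orb_Suc: "orb (Suc k) z = q * orb k z + c" for k z
    unfolding L by (simp add: orb_def)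
  have bor_Suc: "bor k e = q * bor (Suc k) e + c" for k e
    unfolding L using q1 by (simp add: bor_def)
  have orb_bor: "orb k z = e \<Longrightarrow> z = bor k e" for k z e
    using q1 by (auto simp: orb_def bor_def)
  have pow_inj: "inj (\<lambda>k. q ^ k)"
  proof (rule injI)
    fix m n assume "q ^ m = q ^ n"
    hence "cmod q ^ m = cmod q ^ n" by (metis norm_power)
    thus "m = n" using q by (simp add: power_inject_exp')
  qed
  have hit: "\<exists>k. orb k z \<in> E" if z: "d z > 0" "z \<noteq> p" for z
  proof (rule ccontr)
    assume no: "\<nexists>k. orb k z \<in> E"
    have pos: "d (orb k z) > 0" for k
    proof (induction k)
      case 0
      thus ?case using z by (simp add: orb_def)
    next
      case (Suc k)
      thus ?case using mono[of "orb k z"] no by (auto simp: orb_Suc)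
    qed
    have "cmod (orb k z) \<le> cmod p + cmod (z - p)" for k
    proof -
      have "cmod (orb k z) \<le> cmod p + cmod q ^ k * cmod (z - p)"
        unfolding orb_def by (metis norm_mult norm_power norm_triangle_ineq)
      also have "cmod q ^ k * cmod (z - p) \<le> 1 * cmod (z - p)"
        using q by (intro mult_right_mono power_le_one) auto
      finally show ?thesis by simp
    qed
    hence "range (\<lambda>k. orb k z) \<subseteq> {w. cmod w \<le> cmod p + cmod (z - p) \<and> d w > 0}" using pos by auto
    hence "finite (range (\<lambda>k. orb k z))" using fin finite_subset by blast
    moreover have "inj (\<lambda>k. orb k z)"
      using z pow_inj by (auto simp: inj_def orb_def)
    ultimately show False using range_inj_infinite by blast
  qed
  have const: "\<exists>K. \<forall>k\<ge>K. d (bor k e) = d (bor (Suc k) e)" if e: "e \<noteq> p" for e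
  proof -
    have "inj (\<lambda>k. bor k e)"
      using e pow_inj by (auto simp: inj_def bor_def)
    hence "finite ((\<lambda>k. bor k e) -` E)" using E by (intro finite_vimageI)
    then obtain K0 where sub: "(\<lambda>k. bor k e) -` E \<subseteq> {..<K0}"
      using finite_nat_bounded by blast
    have K0: "k < K0" if "bor k e \<in> E" for k using that sub by auto
    have dec1: "d (bor (Suc k) e) \<le> d (bor k e)" if "k \<ge> K0" for k
      using mono[of "bor (Suc k) e"] K0[of "Suc k"] that unfolding bor_Suc[of k e] by force
    have dec: "d (bor n e) \<le> d (bor m e)" if "K0 \<le> m" "m \<le> n" for m n
      using that(2)
    proof (induction n rule: dec_induct)
      case (step n)
      thus ?case using dec1[of n] that(1) by linarith
    qed simp
    \<comment> \<open>The least value from \<open>K0\<close> on is attained at \<open>k1\<close>,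
      and a decreasing sequence stays there.\<close>
    obtain k1 where k1: "k1 \<ge> K0" "\<And>k. k \<ge> K0 \<Longrightarrow> d (bor k1 e) \<le> d (bor k e)"
      using ex_has_least_nat[of "\<lambda>k. k \<ge> K0" K0 "\<lambda>k. d (bor k e)"] by blast
    have eq: "d (bor k e) = d (bor k1 e)" if "k \<ge> k1" for k
      using dec[of k1 k] k1(2)[of k] k1(1) that by linarith
    have "d (bor k e) = d (bor (Suc k) e)" if "k \<ge> k1" for k
      by (rule trans[OF eq[OF that] eq[symmetric]]) (rule le_SucI[OF that])
    thus ?thesis by blast
  qed
  then obtain K where K: "\<And>e k. e \<noteq> p \<Longrightarrow> k \<ge> K e \<Longrightarrow> d (bor k e) = d (bor (Suc k) e)"
    by metis
  have "{z. d z \<noteq> d (q * z + c)} \<subseteq> E \<union> (\<Union>e\<in>E. (\<lambda>k. bor k e) ` {..K e})"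
  proof
    fix z assume "z \<in> {z. d z \<noteq> d (q * z + c)}"
    hence z: "d z \<noteq> d (q * z + c)" by simp
    show "z \<in> E \<union> (\<Union>e\<in>E. (\<lambda>k. bor k e) ` {..K e})"
    proof (cases "z \<in> E")
      case False
      have zp: "z \<noteq> p" using z p by auto
      have "d (q * z + c) > 0" using mono[OF False] z by simp
      moreover have "q * z + c \<noteq> p" using zp q1 by (simp add: L)
      ultimately obtain k where k: "orb k (q * z + c) \<in> E" using hit by blast
      define e where "e = orb (Suc k) z"
      have e_eq: "e = orb k (q * z + c)" by (simp add: e_def orb_def L)
      have zb: "z = bor (Suc k) e" using orb_bor e_def by blast
      have ep: "e \<noteq> p" using zp q1 by (simp add: e_def orb_def)
      have "q * z + c = bor k e" unfolding zb bor_Suc[of k e] ..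
      \<comment> \<open>The step from \<open>z\<close> to its image goes from index
        \<open>Suc k\<close> to \<open>k\<close>. Inequality there means \<open>k < K e\<close>, so
        \<open>Suc k\<close> still lies in \<open>{..K e}\<close>.\<close>
      hence "\<not> k \<ge> K e" using K[OF ep, of k] z zb by metis
      hence "Suc k \<in> {..K e}" by simp
      moreover have "e \<in> E" using k e_eq by simp
      ultimately show ?thesis using zb by blast
    qed simp
  qed
  thus ?thesis by (rule finite_subset) (use E in auto)
qed

text \<open>The orders of \<open>l\<close> and of its composition with the affine map differ only on
  \<open>X\<close>, where the polynomial factors raise both to the larger one. Subtraction on
  \<open>nat\<close> truncates, so at each point at most one of the two factors vanishes.\<close>

lemma functional_equation:
  assumes l: "entire_nz l" and q: "q \<noteq> 0" and X: "finite X"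
    and inv: "\<And>z. z \<notin> X \<Longrightarrow> zmul l z = zmul l (q * z + c)"
  obtains \<phi> where "\<phi> holomorphic_on UNIV"
    "\<And>z. lin_prod X (\<lambda>x. zmul l x - zmul l (q * x + c)) z * l (q * z + c) =
       exp (\<phi> z) * (lin_prod X (\<lambda>x. zmul l (q * x + c) - zmul l x) z * l z)"
proof (rule exp_factorization[where A = UNIV])
  let ?Q = "lin_prod X (\<lambda>x. zmul l x - zmul l (q * x + c))"
  let ?P = "lin_prod X (\<lambda>x. zmul l (q * x + c) - zmul l x)"
  have Lq: "entire_nz (\<lambda>z. l (q * z + c))" by (rule entire_nz_affine[OF l q])
  show "entire_nz (\<lambda>z. ?Q z * l (q * z + c))" "entire_nz (\<lambda>z. ?P z * l z)"
    by (intro entire_nz_mult entire_nz_lin_prod X l Lq)+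
  show "zmul (\<lambda>z. ?Q z * l (q * z + c)) z = zmul (\<lambda>z. ?P z * l z) z" for z
    using inv[of z]
    by (auto simp: zmul_mult[OF entire_nz_lin_prod[OF X] Lq] zmul_mult[OF entire_nz_lin_prod[OF X] l]
        zmul_lin_prod[OF X] zmul_affine[OF l q])
qed (use that in auto)

section \<open>Logarithms along one step of the affine map\<close>

lemma ln_cmod_lin_prod:
  assumes "finite S" "w \<notin> S"
  shows "ln (cmod (lin_prod S m w)) = (\<Sum>x\<in>S. m x * ln (cmod (w - x)))"
  unfolding lin_prod_def prod_norm[symmetric] norm_power
  using assms by (subst ln_prod) (auto simp: ln_realpow intro!: sum.cong)

text \<open>In the half disc the denominators lie within a factor 3 of each other, so moving from
  \<open>w\<close> to \<open>q * w + c\<close> costs at most \<open>ln 3\<close> for each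
  zero.\<close>

lemma blaschke_denominator_bounds:
  assumes "r > 0" "cmod a < r" "cmod w \<le> r / 2"
  shows "r\<^sup>2 / 2 \<le> cmod (of_real (r\<^sup>2) - cnj a * w)" "cmod (of_real (r\<^sup>2) - cnj a * w) \<le> 3 * (r\<^sup>2 / 2)"
proof -
  have "cmod (cnj a * w) \<le> r * (r / 2)"
    unfolding norm_mult by (rule mult_mono) (use assms in auto)
  moreover have "cmod (of_real (r\<^sup>2)) = r\<^sup>2" by (simp add: norm_power)
  ultimately show "r\<^sup>2 / 2 \<le> cmod (of_real (r\<^sup>2) - cnj a * w)"
    "cmod (of_real (r\<^sup>2) - cnj a * w) \<le> 3 * (r\<^sup>2 / 2)"
    using norm_triangle_ineq2[of "of_real (r\<^sup>2)" "cnj a * w"]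
      norm_triangle_ineq4[of "of_real (r\<^sup>2)" "cnj a * w"] by (simp_all add: power2_eq_square)
qed

lemma abs_ln_diff_le:
  assumes "0 < k" "k \<le> x" "x \<le> 3 * k" "k \<le> y" "y \<le> 3 * (k::real)"
  shows "\<bar>ln x - ln y\<bar> \<le> ln 3"
proof -
  have "ln x \<le> ln (3 * k)" "ln y \<le> ln (3 * k)" "ln k \<le> ln x" "ln k \<le> ln y"
    using assms by auto
  moreover have "ln (3 * k) = ln 3 + ln k" using assms by (simp add: ln_mult_pos)
  ultimately show ?thesis by linarith
qed

text \<open>
  The zeros inside the disc are permuted by \<open>z \<mapsto> q z + c\<close> up to the exceptional set \<open>X\<close>, which is
  accounted for by the polynomial factors, and up to points just outside the disc, which are far
  from \<open>w\<close>. Hence the products over the zeros telescope.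
\<close>

lemma telescope:
  fixes d :: "complex \<Rightarrow> nat"
  assumes q: "0 < cmod q" and r: "r \<ge> 2" "cmod q * r + cmod c \<le> r"
    and inv: "\<And>z. z \<notin> X \<Longrightarrow> d z = d (q * z + c)"
    and X: "finite X" "\<And>x. x \<in> X \<Longrightarrow> cmod x < r \<and> cmod (q * x + c) < r"
    and Z: "finite Z" "Z = {a. cmod a < r \<and> d a > 0}"
    and w: "cmod w \<le> r / 2" "d (q * w + c) = 0"
  shows "\<bar>(\<Sum>a\<in>Z. d a * ln (cmod (q * w + c - a))) - (\<Sum>a\<in>Z. d a * ln (cmod (w - a))) +
          (\<Sum>x\<in>X. (real (d x) - real (d (q * x + c))) * ln (cmod (w - x)))\<bar>
       \<le> (\<Sum>a\<in>Z. d a) * (\<bar>ln (cmod q)\<bar> + ln (r / 2 + (r + cmod c) / cmod q))"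
proof -
  have q0: "q \<noteq> 0" using q by auto
  \<comment> \<open>\<open>M\<close> inverts the affine map. Pulling the zeros back by it replaces
    distances from \<open>q * w + c\<close> by distances from \<open>w\<close>, up to the factor
    \<open>q\<close>.\<close>
  define M where "M = (\<lambda>a. (a - c) / q)"
  have LM: "q * M a + c = a" for a using q0 by (simp add: M_def)
  have Mq: "M (q * b + c) = b" for b using q0 by (simp add: M_def)
  have injM: "inj_on M Z" using LM by (metis inj_onI)
  have MZ: "b \<in> M ` Z \<longleftrightarrow> q * b + c \<in> Z" for b
    using LM Mq by (metis image_iff)
  let ?N = "\<Sum>a\<in>Z. real (d a)"
  let ?D = "ln (r / 2 + (r + cmod c) / cmod q)"
  have shift: "(\<Sum>a\<in>Z. d a * ln (cmod (q * w + c - a))) =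
      ?N * ln (cmod q) + (\<Sum>b\<in>M ` Z. d (q * b + c) * ln (cmod (w - b)))"
  proof -
    have "d a * ln (cmod (q * w + c - a)) = d a * ln (cmod q) + d a * ln (cmod (w - M a))"
      if "a \<in> Z" for a
    proof -
      have "q * w + c - a = q * (w - M a)" using q0 by (simp add: M_def field_simps)
      moreover have "w \<noteq> M a" using that w(2) LM[of a] Z(2) by auto
      ultimately show ?thesis using q0 by (simp add: norm_mult ln_mult_pos distrib_left)
    qed
    hence "(\<Sum>a\<in>Z. d a * ln (cmod (q * w + c - a))) =
        (\<Sum>a\<in>Z. d a * ln (cmod q)) + (\<Sum>a\<in>Z. d a * ln (cmod (w - M a)))"
      unfolding sum.distrib[symmetric] by (intro sum.cong) auto
    thus ?thesis by (simp add: sum.reindex[OF injM] LM sum_distrib_right)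
  qed
  \<comment> \<open>\<open>Y\<close> holds the preimages of zeros that fall outside the disc; these
    survive the telescoping. The weights \<open>f1\<close> to \<open>f4\<close> allow all sums to be
    compared over the one index set \<open>W\<close>.\<close>
  define Y where "Y = {b \<in> M ` Z. r \<le> cmod b}"
  define W where "W = M ` Z \<union> Z \<union> X"
  have fin: "finite W" "finite Y" using X Z by (auto simp: W_def Y_def)
  define f1 where "f1 = (\<lambda>b. if b \<in> M ` Z then real (d (q * b + c)) else 0)"
  define f2 where "f2 = (\<lambda>b. if b \<in> Z then real (d b) else 0)"
  define f3 where "f3 = (\<lambda>b. if b \<in> X then real (d b) - real (d (q * b + c)) else 0)"
  define f4 where "f4 = (\<lambda>b. if b \<in> Y then real (d (q * b + c)) else 0)"
  have s1: "(\<Sum>b\<in>M ` Z. d (q * b + c) * ln (cmod (w - b))) = (\<Sum>b\<in>W. f1 b * ln (cmod (w - b)))"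
    by (rule sum.mono_neutral_cong_left) (use fin in \<open>auto simp: f1_def W_def\<close>)
  have s2: "(\<Sum>a\<in>Z. d a * ln (cmod (w - a))) = (\<Sum>b\<in>W. f2 b * ln (cmod (w - b)))"
    by (rule sum.mono_neutral_cong_left) (use fin in \<open>auto simp: f2_def W_def\<close>)
  have s3: "(\<Sum>x\<in>X. (real (d x) - real (d (q * x + c))) * ln (cmod (w - x))) = (\<Sum>b\<in>W. f3 b * ln (cmod (w - b)))"
    by (rule sum.mono_neutral_cong_left) (use fin in \<open>auto simp: f3_def W_def\<close>)
  have s4: "(\<Sum>b\<in>Y. d (q * b + c) * ln (cmod (w - b))) = (\<Sum>b\<in>W. f4 b * ln (cmod (w - b)))"
    by (rule sum.mono_neutral_cong_left) (use fin in \<open>auto simp: f4_def W_def Y_def\<close>)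
  have f: "f1 b - f2 b + f3 b = f4 b" for b
  proof -
    have 1: "f1 b = (if cmod (q * b + c) < r then real (d (q * b + c)) else 0)"
      unfolding f1_def MZ by (auto simp: Z(2))
    have 2: "f2 b = (if cmod b < r then real (d b) else 0)"
      by (auto simp: f2_def Z(2))
    have 4: "f4 b = (if cmod (q * b + c) < r \<and> \<not> cmod b < r then real (d (q * b + c)) else 0)"
      unfolding f4_def Y_def mem_Collect_eq MZ by (auto simp: Z(2))
    have "cmod (q * b + c) < r" if "cmod b < r"
    proof -
      have "cmod (q * b + c) \<le> cmod q * cmod b + cmod c"
        using norm_triangle_ineq[of "q * b" c] by (simp add: norm_mult)
      also have "\<dots> < cmod q * r + cmod c" using that q by simp
      finally show ?thesis using r by simp
    qed
    thus ?thesis unfolding 1 2 4 f3_def using X(2)[of b] inv[of b] by auto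
  qed
  have "(\<Sum>b\<in>W. f1 b * ln (cmod (w - b))) - (\<Sum>b\<in>W. f2 b * ln (cmod (w - b))) + (\<Sum>b\<in>W. f3 b * ln (cmod (w - b)))
      = (\<Sum>b\<in>W. f4 b * ln (cmod (w - b)))"
    unfolding f[symmetric] sum_subtractf[symmetric] sum.distrib[symmetric]
    by (intro sum.cong) (auto simp: algebra_simps)
  hence main: "(\<Sum>a\<in>Z. d a * ln (cmod (q * w + c - a))) - (\<Sum>a\<in>Z. d a * ln (cmod (w - a))) +
          (\<Sum>x\<in>X. (real (d x) - real (d (q * x + c))) * ln (cmod (w - x))) =
          ?N * ln (cmod q) + (\<Sum>b\<in>Y. d (q * b + c) * ln (cmod (w - b)))"
    unfolding shift s1 s2 s3 s4 by simp
  have lnY: "\<bar>ln (cmod (w - b))\<bar> \<le> ?D" if b: "b \<in> Y" for b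
  proof -
    have "cmod b \<ge> r" "b \<in> M ` Z" using b by (auto simp: Y_def)
    then obtain a where a: "a \<in> Z" "b = M a" by auto
    have "cmod b \<le> (cmod a + cmod c) / cmod q"
      unfolding a(2) M_def norm_divide using norm_triangle_ineq4[of a c] q
      by (intro divide_right_mono) auto
    also have "\<dots> \<le> (r + cmod c) / cmod q"
      using a Z(2) q by (intro divide_right_mono) auto
    finally have "cmod (w - b) \<le> r / 2 + (r + cmod c) / cmod q"
      using norm_triangle_ineq4[of w b] w by linarith
    \<comment> \<open>From \<open>cmod b \<ge> r\<close>, \<open>cmod w \<le> r / 2\<close> and
      \<open>r \<ge> 2\<close>; thus the logarithm is nonnegative and only an upper bound is left to
      find.\<close>
    moreover have "cmod (w - b) \<ge> 1"
      using norm_triangle_ineq2[of b w] \<open>cmod b \<ge> r\<close> w r by (simp add: norm_minus_commute)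
    ultimately have "0 \<le> ln (cmod (w - b))" "ln (cmod (w - b)) \<le> ?D"
      by (simp, subst ln_le_cancel_iff) linarith+
    thus ?thesis by simp
  qed
  have "\<bar>\<Sum>b\<in>Y. d (q * b + c) * ln (cmod (w - b))\<bar> \<le> (\<Sum>b\<in>Y. d (q * b + c) * ?D)"
    by (rule order_trans[OF sum_abs]) (auto simp: abs_mult intro!: sum_mono mult_left_mono lnY)
  also have "\<dots> = (\<Sum>b\<in>Y. real (d (q * b + c))) * ?D" by (simp add: sum_distrib_right)
  also have "\<dots> \<le> (\<Sum>b\<in>M ` Z. real (d (q * b + c))) * ?D"
  proof (intro mult_right_mono sum_mono2)
    have "0 \<le> (r + cmod c) / cmod q" using r by simp
    thus "0 \<le> ?D" using r by (intro ln_ge_zero) linarith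
  qed (use Z in \<open>auto simp: Y_def\<close>)
  also have "(\<Sum>b\<in>M ` Z. real (d (q * b + c))) = ?N"
    by (simp add: sum.reindex[OF injM] LM)
  finally have "\<bar>\<Sum>b\<in>Y. d (q * b + c) * ln (cmod (w - b))\<bar> \<le> ?N * ?D" .
  moreover have "\<bar>?N * ln (cmod q)\<bar> = ?N * \<bar>ln (cmod q)\<bar>"
    by (simp add: abs_mult sum_nonneg)
  ultimately show ?thesis unfolding main
    using abs_triangle_ineq[of "?N * ln (cmod q)" "\<Sum>b\<in>Y. d (q * b + c) * ln (cmod (w - b))"]
    by (simp add: distrib_left)
qed

text \<open>Logarithms are taken in the functional equation, and the Blaschke form of
  \<open>l\<close> is inserted at \<open>w\<close> and at its image. The distances to the zeros
  telescope and the denominators nearly cancel. What remains is the increment of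
  \<open>Re \<kappa>\<close> and a logarithmic error for each zero.\<close>

lemma Re_exponent_approx:
  assumes l: "entire_nz l" and q: "0 < cmod q" and r: "r \<ge> 2" "cmod q * r + cmod c \<le> r"
    and inv: "\<And>z. z \<notin> X \<Longrightarrow> zmul l z = zmul l (q * z + c)"
    and X: "finite X" "\<And>x. x \<in> X \<Longrightarrow> cmod x < r \<and> cmod (q * x + c) < r"
    and \<phi>: "\<And>z. lin_prod X (\<lambda>x. zmul l x - zmul l (q * x + c)) z * l (q * z + c) =
       exp (\<phi> z) * (lin_prod X (\<lambda>x. zmul l (q * x + c) - zmul l x) z * l z)"
    and \<kappa>: "\<And>z. cmod z < R \<Longrightarrow>
       l z * (\<Prod>a\<in>zeros_in l r. (of_real (r\<^sup>2) - cnj a * z) ^ zmul l a) =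
       exp (\<kappa> z) * (\<Prod>a\<in>zeros_in l r. (of_real r * (z - a)) ^ zmul l a)"
    and R: "r < R"
    and w: "cmod w \<le> r / 2" "cmod (q * w + c) \<le> r / 2" "l w \<noteq> 0" "l (q * w + c) \<noteq> 0" "w \<notin> X"
  shows "\<bar>Re (\<phi> w) - (Re (\<kappa> (q * w + c)) - Re (\<kappa> w))\<bar> \<le>
    (\<Sum>a\<in>zeros_in l r. zmul l a) * (\<bar>ln (cmod q)\<bar> + ln (r / 2 + (r + cmod c) / cmod q) + ln 3)"
proof -
  let ?Z = "zeros_in l r" and ?v = "q * w + c" and ?d = "zmul l"
  have fZ: "finite ?Z" using l by (rule finite_zeros_in)
  have Z: "?Z = {a. cmod a < r \<and> ?d a > 0}" using zmul_eq_0_iff[OF l] by (auto simp: zeros_in_def simp flip: neq0_conv)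
  have r0: "r > 0" using r by simp
  let ?B = "\<lambda>z. \<Sum>a\<in>?Z. ?d a * ln (cmod (of_real (r\<^sup>2) - cnj a * z))"
  let ?S = "\<lambda>z. \<Sum>a\<in>?Z. ?d a * ln (cmod (z - a))"
  have lnl: "ln (cmod (l z)) = Re (\<kappa> z) + (\<Sum>a\<in>?Z. ?d a * ln r) + ?S z - ?B z"
    if z: "cmod z \<le> r / 2" "l z \<noteq> 0" for z
  proof -
    have "ln (cmod (l z)) = Re (\<kappa> z) + (\<Sum>a\<in>?Z. ?d a *
        (ln (r * cmod (z - a)) - ln (cmod (of_real (r\<^sup>2) - cnj a * z))))"
      by (rule ln_blaschke[OF l \<kappa>]) (use z r R in auto)
    also have "(\<Sum>a\<in>?Z. ?d a * (ln (r * cmod (z - a)) - ln (cmod (of_real (r\<^sup>2) - cnj a * z)))) =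
        (\<Sum>a\<in>?Z. ?d a * ln r + ?d a * ln (cmod (z - a)) - ?d a * ln (cmod (of_real (r\<^sup>2) - cnj a * z)))"
    proof (rule sum.cong)
      fix a assume "a \<in> ?Z"
      hence "cmod (z - a) > 0" using z by (auto simp: zeros_in_def)
      thus "?d a * (ln (r * cmod (z - a)) - ln (cmod (of_real (r\<^sup>2) - cnj a * z))) =
         ?d a * ln r + ?d a * ln (cmod (z - a)) - ?d a * ln (cmod (of_real (r\<^sup>2) - cnj a * z))"
        using r0 by (simp add: ln_mult_pos algebra_simps)
    qed simp
    finally show ?thesis by (simp add: sum.distrib sum_subtractf)
  qed
  have "ln (cmod (lin_prod X (\<lambda>x. ?d x - ?d (q * x + c)) w * l ?v)) =
      ln (cmod (exp (\<phi> w) * (lin_prod X (\<lambda>x. ?d (q * x + c) - ?d x) w * l w)))"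
    using \<phi>[of w] by simp
  hence "(\<Sum>x\<in>X. (?d x - ?d (q * x + c)) * ln (cmod (w - x))) + ln (cmod (l ?v)) =
     Re (\<phi> w) + ((\<Sum>x\<in>X. (?d (q * x + c) - ?d x) * ln (cmod (w - x))) + ln (cmod (l w)))"
    using w X(1) unfolding ln_cmod_lin_prod[OF X(1) w(5), symmetric]
    by (simp add: norm_mult ln_mult_pos lin_prod_eq_0_iff)
  hence "Re (\<phi> w) = ln (cmod (l ?v)) - ln (cmod (l w)) +
     ((\<Sum>x\<in>X. (?d x - ?d (q * x + c)) * ln (cmod (w - x))) - (\<Sum>x\<in>X. (?d (q * x + c) - ?d x) * ln (cmod (w - x))))"
    by simp
  \<comment> \<open>The two truncated differences recombine to one signed difference, the weight in
    \<open>telescope\<close>.\<close>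
  also have "(\<Sum>x\<in>X. (?d x - ?d (q * x + c)) * ln (cmod (w - x))) - (\<Sum>x\<in>X. (?d (q * x + c) - ?d x) * ln (cmod (w - x)))
     = (\<Sum>x\<in>X. (real (?d x) - real (?d (q * x + c))) * ln (cmod (w - x)))"
    unfolding sum_subtractf[symmetric] left_diff_distrib[symmetric]
    by (intro sum.cong arg_cong2[where f = "(*)"]) (auto simp: of_nat_diff_if)
  finally have eq: "Re (\<phi> w) - (Re (\<kappa> ?v) - Re (\<kappa> w)) =
      (?S ?v - ?S w + (\<Sum>x\<in>X. (real (?d x) - real (?d (q * x + c))) * ln (cmod (w - x)))) + (?B w - ?B ?v)"
    unfolding lnl[OF w(1,3)] lnl[OF w(2,4)] by simp
  have 1: "\<bar>?S ?v - ?S w + (\<Sum>x\<in>X. (real (?d x) - real (?d (q * x + c))) * ln (cmod (w - x)))\<bar> \<le>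
      (\<Sum>a\<in>?Z. ?d a) * (\<bar>ln (cmod q)\<bar> + ln (r / 2 + (r + cmod c) / cmod q))"
    by (rule telescope[OF q r inv X fZ Z w(1)]) (use zmul_eq_0_iff[OF l] w in auto)
  have "\<bar>?B w - ?B ?v\<bar> \<le> (\<Sum>a\<in>?Z. ?d a * ln 3)"
    unfolding sum_subtractf[symmetric] right_diff_distrib[symmetric]
  proof (rule order_trans[OF sum_abs], rule sum_mono)
    fix a assume "a \<in> ?Z"
    hence a: "cmod a < r" by (simp add: zeros_in_def)
    have "\<bar>ln (cmod (of_real (r\<^sup>2) - cnj a * w)) - ln (cmod (of_real (r\<^sup>2) - cnj a * ?v))\<bar> \<le> ln 3"
      by (rule abs_ln_diff_le[where k = "r\<^sup>2 / 2"])
         (use blaschke_denominator_bounds[OF r0 a] w r0 in auto)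
    thus "\<bar>?d a * (ln (cmod (of_real (r\<^sup>2) - cnj a * w)) - ln (cmod (of_real (r\<^sup>2) - cnj a * ?v)))\<bar> \<le> ?d a * ln 3"
      by (simp add: abs_mult mult_left_mono)
  qed
  hence 2: "\<bar>?B w - ?B ?v\<bar> \<le> (\<Sum>a\<in>?Z. ?d a) * ln 3" by (simp add: sum_distrib_right)
  show ?thesis unfolding eq using 1 2 by (simp add: distrib_left)
qed

section \<open>Comparison of the exponents of two forms\<close>

lemma exists_generic_radius:
  assumes H: "entire_nz H" and ab: "a < b"
  obtains s where "a < s" "s < b" "\<And>z. cmod z = s \<Longrightarrow> H z \<noteq> 0"
proof -
  have "finite (cmod ` {z. cmod z \<le> b \<and> H z = 0})"
    using finite_zeros_cball[OF H] by simp
  moreover have "infinite {a<..<b}" using ab by simp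
  ultimately obtain s where s: "s \<in> {a<..<b}" "s \<notin> cmod ` {z. cmod z \<le> b \<and> H z = 0}"
    by (meson finite_subset subsetI)
  show ?thesis by (rule that[of s]) (use s in auto)
qed

text \<open>\<open>sqrt r * ln r\<close> is of smaller order than \<open>r\<close>. The left side is
  the total error in \<open>exponent_difference_constant\<close>: a bound of 3 means on
  \<open>Re \<kappa>\<close> at two points, and one \<open>Re_exponent_approx\<close> for each of
  two forms.\<close>

lemma eventually_sqrt_ln_small:
  assumes "e > 0"
  shows "\<forall>\<^sub>F r in at_top. 6 * (K * sqrt r) + 2 * (K * sqrt r * (a + 2 * ln r)) \<le> e * r"
proof -
  have 1: "((\<lambda>r::real. sqrt r / r) \<longlongrightarrow> 0) at_top" by real_asymp
  have 2: "((\<lambda>r::real. sqrt r * ln r / r) \<longlongrightarrow> 0) at_top" by real_asymp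
  have "((\<lambda>r. (6 * K + 2 * K * a) * (sqrt r / r) + 4 * K * (sqrt r * ln r / r)) \<longlongrightarrow>
      (6 * K + 2 * K * a) * 0 + 4 * K * 0) at_top"
    by (intro tendsto_intros 1 2)
  hence "\<forall>\<^sub>F r in at_top. (6 * K + 2 * K * a) * (sqrt r / r) + 4 * K * (sqrt r * ln r / r) < e"
    by (rule order_tendstoD(2)) (use assms in simp)
  thus ?thesis
    using eventually_gt_at_top[of 0]
  proof eventually_elim
    case (elim r)
    have "6 * (K * sqrt r) + 2 * (K * sqrt r * (a + 2 * ln r)) =
        ((6 * K + 2 * K * a) * (sqrt r / r) + 4 * K * (sqrt r * ln r / r)) * r"
      using elim(2) by (simp add: field_simps)
    also have "\<dots> \<le> e * r" using elim by (intro mult_right_mono) auto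
    finally show ?case .
  qed
qed

text \<open>A common zero-free factor of the two forms is arbitrary, so only their quotient, and the
  difference of the exponents, can be controlled. On the circle
  \<open>Re (\<kappa>1 - \<kappa>2)\<close> has absolute mean \<open>O(sqrt r)\<close>, so it is
  \<open>O(sqrt r)\<close> on the half disc, and \<open>Re_exponent_approx\<close> transfers this to
  \<open>Re (\<phi>1 - \<phi>2)\<close>.\<close>

lemma exponent_difference_constant:
  assumes q: "0 < cmod q" "cmod q < 1"
    and l1: "entire_nz l1" and l2: "entire_nz l2" and H: "entire_nz H"
    and H12: "\<And>z. H z \<noteq> 0 \<Longrightarrow> l1 z \<noteq> 0 \<and> l2 z \<noteq> 0"
    and X1: "finite X1" "\<And>z. z \<notin> X1 \<Longrightarrow> zmul l1 z = zmul l1 (q * z + c)"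
    and X2: "finite X2" "\<And>z. z \<notin> X2 \<Longrightarrow> zmul l2 z = zmul l2 (q * z + c)"
    and \<phi>1: "\<phi>1 holomorphic_on UNIV"
      "\<And>z. lin_prod X1 (\<lambda>x. zmul l1 x - zmul l1 (q * x + c)) z * l1 (q * z + c) =
       exp (\<phi>1 z) * (lin_prod X1 (\<lambda>x. zmul l1 (q * x + c) - zmul l1 x) z * l1 z)"
    and \<phi>2: "\<phi>2 holomorphic_on UNIV"
      "\<And>z. lin_prod X2 (\<lambda>x. zmul l2 x - zmul l2 (q * x + c)) z * l2 (q * z + c) =
       exp (\<phi>2 z) * (lin_prod X2 (\<lambda>x. zmul l2 (q * x + c) - zmul l2 x) z * l2 z)"
    and growth: "\<forall>\<^sub>F r in at_top. (\<forall>z. cmod z = r \<or> cmod z = 2 * r \<longrightarrow> H z \<noteq> 0) \<longrightarrow>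
        circ_mean (\<lambda>z. \<bar>ln (cmod (l1 z)) - ln (cmod (l2 z))\<bar>) r \<le> K * sqrt r \<and>
        (\<Sum>a\<in>zeros_in l1 r. real (zmul l1 a)) \<le> K * sqrt r \<and>
        (\<Sum>a\<in>zeros_in l2 r. real (zmul l2 a)) \<le> K * sqrt r"
  shows "\<phi>1 w - \<phi>2 w = \<phi>1 0 - \<phi>2 0"
proof (rule entire_Re_sublinear_imp_constant)
  show "(\<lambda>w. \<phi>1 w - \<phi>2 w) holomorphic_on UNIV" by (intro holomorphic_intros \<phi>1 \<phi>2)
next
  fix e R :: real assume e: "e > 0"
  have q0: "q \<noteq> 0" using q by auto
  let ?a = "\<bar>ln (cmod q)\<bar> + ln 3"
  have fX: "finite (X1 \<union> X2)" using X1 X2 by simp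
  have X_ev: "\<forall>\<^sub>F r in at_top. \<forall>x\<in>X1 \<union> X2. cmod x < r \<and> cmod (q * x + c) < r"
    by (intro eventually_ball_finite fX ballI eventually_conj eventually_gt_at_top)
  have bound_ev: "\<forall>\<^sub>F r in at_top. r / 2 + (r + cmod c) / cmod q \<le> r ^ 2"
    using q by real_asymp
  have "\<forall>\<^sub>F r in at_top.
      ((\<forall>z. cmod z = r \<or> cmod z = 2 * r \<longrightarrow> H z \<noteq> 0) \<longrightarrow>
        circ_mean (\<lambda>z. \<bar>ln (cmod (l1 z)) - ln (cmod (l2 z))\<bar>) r \<le> K * sqrt r \<and>
        (\<Sum>a\<in>zeros_in l1 r. real (zmul l1 a)) \<le> K * sqrt r \<and>
        (\<Sum>a\<in>zeros_in l2 r. real (zmul l2 a)) \<le> K * sqrt r) \<and>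
      (\<forall>x\<in>X1 \<union> X2. cmod x < r \<and> cmod (q * x + c) < r) \<and>
      r / 2 + (r + cmod c) / cmod q \<le> r ^ 2 \<and>
      6 * (K * sqrt r) + 2 * (K * sqrt r * (?a + 2 * ln r)) \<le> e / 4 * r \<and>
      r \<ge> max 2 (4 * R) \<and> r \<ge> 2 * cmod c / (1 - cmod q)"
    by (intro eventually_conj growth X_ev bound_ev eventually_sqrt_ln_small eventually_ge_at_top) (use e in simp)
  then obtain r0 where r0: "\<And>r. r \<ge> r0 \<Longrightarrow>
      ((\<forall>z. cmod z = r \<or> cmod z = 2 * r \<longrightarrow> H z \<noteq> 0) \<longrightarrow>
        circ_mean (\<lambda>z. \<bar>ln (cmod (l1 z)) - ln (cmod (l2 z))\<bar>) r \<le> K * sqrt r \<and>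
        (\<Sum>a\<in>zeros_in l1 r. real (zmul l1 a)) \<le> K * sqrt r \<and>
        (\<Sum>a\<in>zeros_in l2 r. real (zmul l2 a)) \<le> K * sqrt r) \<and>
      (\<forall>x\<in>X1 \<union> X2. cmod x < r \<and> cmod (q * x + c) < r) \<and>
      r / 2 + (r + cmod c) / cmod q \<le> r ^ 2 \<and>
      6 * (K * sqrt r) + 2 * (K * sqrt r * (?a + 2 * ln r)) \<le> e / 4 * r \<and>
      r \<ge> max 2 (4 * R) \<and> r \<ge> 2 * cmod c / (1 - cmod q)"
    by (auto simp only: eventually_at_top_linorder)
  \<comment> \<open>The zeros of \<open>H\<close> are to be avoided on both circles, of radius
    \<open>r\<close> and \<open>2 * r\<close>, hence the product of \<open>H z\<close> and
    \<open>H (2 * z)\<close>.\<close>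
  obtain r where r: "r0 < r" "\<And>z. cmod z = r \<Longrightarrow> H z * H (2 * z + 0) \<noteq> 0"
    using exists_generic_radius[OF entire_nz_mult[OF H entire_nz_affine[OF H, of 2 0]], of r0 "r0 + 1"]
    by auto
  have gen1: "H z \<noteq> 0" if "cmod z = r" for z using r(2)[OF that] by simp
  have gen2: "H z \<noteq> 0" if "cmod z = 2 * r" for z
    using r(2)[of "z / 2"] that by (simp add: norm_divide)
  have gen: "\<forall>z. cmod z = r \<or> cmod z = 2 * r \<longrightarrow> H z \<noteq> 0" using gen1 gen2 by blast
  note R0 = r0[OF less_imp_le[OF r(1)]]
  have mean: "circ_mean (\<lambda>z. \<bar>ln (cmod (l1 z)) - ln (cmod (l2 z))\<bar>) r \<le> K * sqrt r"
    and N1: "(\<Sum>a\<in>zeros_in l1 r. real (zmul l1 a)) \<le> K * sqrt r"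
    and N2: "(\<Sum>a\<in>zeros_in l2 r. real (zmul l2 a)) \<le> K * sqrt r"
    using R0 gen by blast+
  have XX: "\<And>x. x \<in> X1 \<union> X2 \<Longrightarrow> cmod x < r \<and> cmod (q * x + c) < r"
    and rq: "r / 2 + (r + cmod c) / cmod q \<le> r ^ 2"
    and small: "6 * (K * sqrt r) + 2 * (K * sqrt r * (?a + 2 * ln r)) \<le> e / 4 * r"
    using R0 by blast+
  have r2: "r \<ge> 2" "r \<ge> 4 * R" using R0 by auto
  have "2 * cmod c / (1 - cmod q) \<le> r" using R0 by blast
  \<comment> \<open>Halved, this says that the affine map sends the disc of radius
    \<open>r / 2\<close> into itself.\<close>
  hence qc: "cmod q * r + 2 * cmod c \<le> r" using q by (simp add: field_simps)
  have qc': "cmod q * r + cmod c \<le> r" using qc norm_ge_zero[of c] by linarith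
  have rpos: "r > 0" using r2 by simp
  have nz1: "l1 z \<noteq> 0" and nz2: "l2 z \<noteq> 0" if "cmod z = r" for z
    using gen1[OF that] H12 by auto
  obtain R1 \<kappa>1 where \<kappa>1: "R1 > r" "\<kappa>1 holomorphic_on ball 0 R1"
    "\<And>z. cmod z < R1 \<Longrightarrow>
       l1 z * (\<Prod>a\<in>zeros_in l1 r. (of_real (r\<^sup>2) - cnj a * z) ^ zmul l1 a) =
       exp (\<kappa>1 z) * (\<Prod>a\<in>zeros_in l1 r. (of_real r * (z - a)) ^ zmul l1 a)"
    using blaschke_factorization[OF l1 rpos nz1] by blast
  obtain R2 \<kappa>2 where \<kappa>2: "R2 > r" "\<kappa>2 holomorphic_on ball 0 R2"
    "\<And>z. cmod z < R2 \<Longrightarrow>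
       l2 z * (\<Prod>a\<in>zeros_in l2 r. (of_real (r\<^sup>2) - cnj a * z) ^ zmul l2 a) =
       exp (\<kappa>2 z) * (\<Prod>a\<in>zeros_in l2 r. (of_real r * (z - a)) ^ zmul l2 a)"
    using blaschke_factorization[OF l2 rpos nz2] by blast
  define \<kappa> where "\<kappa> = (\<lambda>z. \<kappa>1 z - \<kappa>2 z)"
  have \<kappa>_hol: "\<kappa> holomorphic_on ball 0 (min R1 R2)"
    unfolding \<kappa>_def
    by (intro holomorphic_intros holomorphic_on_subset[OF \<kappa>1(2)] holomorphic_on_subset[OF \<kappa>2(2)]) auto
  have "circ_mean (\<lambda>z. \<bar>Re (\<kappa> z)\<bar>) r = circ_mean (\<lambda>z. \<bar>ln (cmod (l1 z)) - ln (cmod (l2 z))\<bar>) r"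
  proof (rule circ_mean_cong)
    fix z assume z: "cmod z = r"
    have nz: "l1 z \<noteq> 0" "l2 z \<noteq> 0" using gen1[OF z] H12 by auto
    have "ln (cmod (l1 z)) = Re (\<kappa>1 z)"
      by (rule ln_blaschke_sphere[OF l1 \<kappa>1(3)]) (use z nz rpos \<kappa>1(1) in auto)
    moreover have "ln (cmod (l2 z)) = Re (\<kappa>2 z)"
      by (rule ln_blaschke_sphere[OF l2 \<kappa>2(3)]) (use z nz rpos \<kappa>2(1) in auto)
    ultimately show "\<bar>Re (\<kappa> z)\<bar> = \<bar>ln (cmod (l1 z)) - ln (cmod (l2 z))\<bar>" by (simp add: \<kappa>_def)
  qed (use rpos in simp)
  hence mean': "circ_mean (\<lambda>z. \<bar>Re (\<kappa> z)\<bar>) r \<le> K * sqrt r" using mean by simp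
  have Re_\<kappa>: "\<bar>Re (\<kappa> z)\<bar> \<le> 3 * (K * sqrt r)" if "cmod z \<le> r / 2" for z
    using Re_bound_half_disc[OF \<kappa>_hol rpos _ that] \<kappa>1(1) \<kappa>2(1) mean' by simp
  have lq: "entire_nz (\<lambda>z. l1 (q * z + c))" "entire_nz (\<lambda>z. l2 (q * z + c))"
    using l1 l2 q0 by (auto intro: entire_nz_affine)
  \<comment> \<open>\<open>G\<close> vanishes where a form is 0 at \<open>z\<close> or at its image,
    or where \<open>z\<close> lies in \<open>X1 \<union> X2\<close>. The radius found for it exceeds
    \<open>r / 4\<close>, so the error \<open>e / 4 * r\<close> is below
    \<open>e * s\<close>.\<close>
  define G where "G = (\<lambda>z. (l1 z * l2 z) * ((l1 (q * z + c) * l2 (q * z + c)) * lin_prod (X1 \<union> X2) (\<lambda>_. 1) z))"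
  have "entire_nz G"
    unfolding G_def by (intro entire_nz_mult l1 l2 lq entire_nz_lin_prod fX)
  then obtain s where s: "r / 4 < s" "s < r / 2" "\<And>z. cmod z = s \<Longrightarrow> G z \<noteq> 0"
    using exists_generic_radius[of G "r / 4" "r / 2"] rpos by auto
  show "\<exists>s\<ge>R. \<forall>z. cmod z = s \<longrightarrow> \<bar>Re (\<phi>1 z - \<phi>2 z)\<bar> \<le> e * s"
  proof (intro exI[of _ s] conjI allI impI)
    show "R \<le> s" using s r2 by simp
    fix z assume z: "cmod z = s"
    have nz: "l1 z \<noteq> 0" "l2 z \<noteq> 0" "l1 (q * z + c) \<noteq> 0" "l2 (q * z + c) \<noteq> 0" "z \<notin> X1" "z \<notin> X2"
      using s(3)[OF z] fX by (auto simp: G_def lin_prod_eq_0_iff)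
    have zr: "cmod z \<le> r / 2" using z s by simp
    have "cmod (q * z + c) \<le> cmod q * cmod z + cmod c"
      using norm_triangle_ineq[of "q * z" c] by (simp add: norm_mult)
    also have "cmod q * cmod z \<le> cmod q * (r / 2)" using zr by (intro mult_left_mono) auto
    finally have qzr: "cmod (q * z + c) \<le> r / 2" using qc by simp
    let ?D = "\<bar>ln (cmod q)\<bar> + ln (r / 2 + (r + cmod c) / cmod q) + ln 3"
    have "ln (r / 2 + (r + cmod c) / cmod q) \<le> ln (r\<^sup>2)"
      using rq rpos q by (subst ln_le_cancel_iff) (auto intro!: add_pos_nonneg divide_nonneg_pos)
    also have "ln (r\<^sup>2) = 2 * ln r" using rpos by (simp add: ln_realpow)
    finally have D: "?D \<le> ?a + 2 * ln r" by simp
    have "1 \<le> r / 2 + (r + cmod c) / cmod q"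
      using r2 rpos q by (intro order_trans[OF _ add_increasing2]) auto
    hence D0: "0 \<le> ?D" by (intro add_nonneg_nonneg) auto
    have A1: "\<bar>Re (\<phi>1 z) - (Re (\<kappa>1 (q * z + c)) - Re (\<kappa>1 z))\<bar> \<le> (\<Sum>a\<in>zeros_in l1 r. zmul l1 a) * ?D"
      by (rule Re_exponent_approx[OF l1 q(1) r2(1) qc' X1(2,1) _ \<phi>1(2) \<kappa>1(3,1) zr qzr nz(1,3,5)])
         (use XX in auto)
    have A2: "\<bar>Re (\<phi>2 z) - (Re (\<kappa>2 (q * z + c)) - Re (\<kappa>2 z))\<bar> \<le> (\<Sum>a\<in>zeros_in l2 r. zmul l2 a) * ?D"
      by (rule Re_exponent_approx[OF l2 q(1) r2(1) qc' X2(2,1) _ \<phi>2(2) \<kappa>2(3,1) zr qzr nz(2,4,6)])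
         (use XX in auto)
    have K0: "0 \<le> K * sqrt r" using N1 by (rule order_trans[rotated]) (simp add: sum_nonneg)
    have KD: "K * sqrt r * ?D \<le> K * sqrt r * (?a + 2 * ln r)"
      using D K0 by (rule mult_left_mono)
    have B1: "(\<Sum>a\<in>zeros_in l1 r. zmul l1 a) * ?D \<le> K * sqrt r * ?D"
      using mult_right_mono[OF N1 D0] by simp
    have B2: "(\<Sum>a\<in>zeros_in l2 r. zmul l2 a) * ?D \<le> K * sqrt r * ?D"
      using mult_right_mono[OF N2 D0] by simp
    have "Re (\<phi>1 z - \<phi>2 z) = (Re (\<phi>1 z) - (Re (\<kappa>1 (q * z + c)) - Re (\<kappa>1 z)))
        - (Re (\<phi>2 z) - (Re (\<kappa>2 (q * z + c)) - Re (\<kappa>2 z))) + (Re (\<kappa> (q * z + c)) - Re (\<kappa> z))"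
      by (simp add: \<kappa>_def)
    hence "\<bar>Re (\<phi>1 z - \<phi>2 z)\<bar> \<le> 2 * (K * sqrt r * (?a + 2 * ln r)) + 6 * (K * sqrt r)"
      using A1 A2 B1 B2 KD Re_\<kappa>[OF zr] Re_\<kappa>[OF qzr] by linarith
    also have "\<dots> \<le> e / 4 * r" using small by simp
    also have "\<dots> \<le> e * s" using s(1) e by simp
    finally show "\<bar>Re (\<phi>1 z - \<phi>2 z)\<bar> \<le> e * s" .
  qed
qed

section \<open>Three linear forms of a quotient of entire functions\<close>

text \<open>Both forms are compared with \<open>B\<close>, and the triangle inequality passes to
  their quotient.\<close>

lemma pair_growth:
  assumes g: "mero_rep g A B"
    and l1: "entire_nz (lform A B v1)" and l2: "entire_nz (lform A B v2)"
    and T: "\<forall>\<^sub>F r in at_top. nevanlinna_T g r \<le> sqrt r"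
  obtains K where "\<forall>\<^sub>F r in at_top.
      (\<forall>z. cmod z = r \<or> cmod z = 2 * r \<longrightarrow> B z * (lform A B v1 z * lform A B v2 z) \<noteq> 0) \<longrightarrow>
        circ_mean (\<lambda>z. \<bar>ln (cmod (lform A B v1 z)) - ln (cmod (lform A B v2 z))\<bar>) r \<le> K * sqrt r \<and>
        (\<Sum>a\<in>zeros_in (lform A B v1) r. real (zmul (lform A B v1) a)) \<le> K * sqrt r \<and>
        (\<Sum>a\<in>zeros_in (lform A B v2) r. real (zmul (lform A B v2) a)) \<le> K * sqrt r"
proof -
  let ?l1 = "lform A B v1" and ?l2 = "lform A B v2"
  have B: "entire_nz B" using g by (simp add: mero_rep_def)
  obtain K1 r1 where K1: "\<forall>r\<ge>r1. (\<forall>z. cmod z = r \<longrightarrow> B z \<noteq> 0 \<and> ?l1 z \<noteq> 0) \<longrightarrow>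
     circ_mean (\<lambda>z. \<bar>ln (cmod (?l1 z)) - ln (cmod (B z))\<bar>) r \<le> K1 * sqrt r \<and>
     circ_mean (\<lambda>z. ln (cmod (?l1 z))) r \<le> K1 * sqrt r"
    using lform_growth[OF g l1 T] by blast
  obtain K2 r2 where K2: "\<forall>r\<ge>r2. (\<forall>z. cmod z = r \<longrightarrow> B z \<noteq> 0 \<and> ?l2 z \<noteq> 0) \<longrightarrow>
     circ_mean (\<lambda>z. \<bar>ln (cmod (?l2 z)) - ln (cmod (B z))\<bar>) r \<le> K2 * sqrt r \<and>
     circ_mean (\<lambda>z. ln (cmod (?l2 z))) r \<le> K2 * sqrt r"
    using lform_growth[OF g l2 T] by blast
  obtain K3 r3 where K3: "\<forall>r\<ge>r3. (\<forall>z. cmod z = 2 * r \<longrightarrow> B z \<noteq> 0 \<and> ?l1 z \<noteq> 0) \<longrightarrow>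
     (\<Sum>a\<in>zeros_in ?l1 r. real (zmul ?l1 a)) \<le> K3 * sqrt r"
    using lform_zero_count[OF g l1 T] by blast
  obtain K4 r4 where K4: "\<forall>r\<ge>r4. (\<forall>z. cmod z = 2 * r \<longrightarrow> B z \<noteq> 0 \<and> ?l2 z \<noteq> 0) \<longrightarrow>
     (\<Sum>a\<in>zeros_in ?l2 r. real (zmul ?l2 a)) \<le> K4 * sqrt r"
    using lform_zero_count[OF g l2 T] by blast
  let ?K = "\<bar>K1\<bar> + \<bar>K2\<bar> + \<bar>K3\<bar> + \<bar>K4\<bar>"
  have "\<forall>\<^sub>F r in at_top. r \<ge> r1 \<and> r \<ge> r2 \<and> r \<ge> r3 \<and> r \<ge> r4 \<and> r \<ge> 0"
    by (intro eventually_conj eventually_ge_at_top)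
  hence "\<forall>\<^sub>F r in at_top.
      (\<forall>z. cmod z = r \<or> cmod z = 2 * r \<longrightarrow> B z * (?l1 z * ?l2 z) \<noteq> 0) \<longrightarrow>
        circ_mean (\<lambda>z. \<bar>ln (cmod (?l1 z)) - ln (cmod (?l2 z))\<bar>) r \<le> ?K * sqrt r \<and>
        (\<Sum>a\<in>zeros_in ?l1 r. real (zmul ?l1 a)) \<le> ?K * sqrt r \<and>
        (\<Sum>a\<in>zeros_in ?l2 r. real (zmul ?l2 a)) \<le> ?K * sqrt r"
  proof eventually_elim
    case (elim r)
    show ?case
    proof
      assume gen: "\<forall>z. cmod z = r \<or> cmod z = 2 * r \<longrightarrow> B z * (?l1 z * ?l2 z) \<noteq> 0"
      have g1: "\<forall>z. cmod z = r \<longrightarrow> B z \<noteq> 0 \<and> ?l1 z \<noteq> 0" "\<forall>z. cmod z = r \<longrightarrow> B z \<noteq> 0 \<and> ?l2 z \<noteq> 0"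
        and g2: "\<forall>z. cmod z = 2 * r \<longrightarrow> B z \<noteq> 0 \<and> ?l1 z \<noteq> 0" "\<forall>z. cmod z = 2 * r \<longrightarrow> B z \<noteq> 0 \<and> ?l2 z \<noteq> 0"
        using gen by auto
      have cB: "continuous_on (sphere 0 r) (\<lambda>z. ln (cmod (B z)))"
        by (rule continuous_on_ln_cmod[OF entire_nz_continuous[OF B]]) (use g1 in auto)
      have c1: "continuous_on (sphere 0 r) (\<lambda>z. ln (cmod (?l1 z)))"
        by (rule continuous_on_ln_cmod[OF entire_nz_continuous[OF l1]]) (use g1 in auto)
      have c2: "continuous_on (sphere 0 r) (\<lambda>z. ln (cmod (?l2 z)))"
        by (rule continuous_on_ln_cmod[OF entire_nz_continuous[OF l2]]) (use g1 in auto)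
      let ?u1 = "\<lambda>z. \<bar>ln (cmod (?l1 z)) - ln (cmod (B z))\<bar>"
      let ?u2 = "\<lambda>z. \<bar>ln (cmod (?l2 z)) - ln (cmod (B z))\<bar>"
      have cu: "continuous_on (sphere 0 r) ?u1" "continuous_on (sphere 0 r) ?u2"
        "continuous_on (sphere 0 r) (\<lambda>z. \<bar>ln (cmod (?l1 z)) - ln (cmod (?l2 z))\<bar>)"
        by (intro continuous_intros c1 c2 cB)+
      have "circ_mean (\<lambda>z. \<bar>ln (cmod (?l1 z)) - ln (cmod (?l2 z))\<bar>) r \<le> circ_mean (\<lambda>z. ?u1 z + ?u2 z) r"
        by (rule circ_mean_mono[OF cu(3) continuous_on_add[OF cu(1,2)]]) (use elim in auto)
      also have "\<dots> = circ_mean ?u1 r + circ_mean ?u2 r"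
        by (rule circ_mean_add[OF cu(1,2)]) (use elim in simp)
      also have "\<dots> \<le> K1 * sqrt r + K2 * sqrt r"
        using K1 K2 g1 elim by (intro add_mono) blast+
      finally have 1: "circ_mean (\<lambda>z. \<bar>ln (cmod (?l1 z)) - ln (cmod (?l2 z))\<bar>) r \<le> (K1 + K2) * sqrt r"
        by (simp add: distrib_right)
      have 3: "(\<Sum>a\<in>zeros_in ?l1 r. real (zmul ?l1 a)) \<le> K3 * sqrt r" using K3 g2 elim by blast
      have 4: "(\<Sum>a\<in>zeros_in ?l2 r. real (zmul ?l2 a)) \<le> K4 * sqrt r" using K4 g2 elim by blast
      have le: "K' * sqrt r \<le> ?K * sqrt r" if "K' \<le> ?K" for K'
        using that elim by (intro mult_right_mono) auto
      show "circ_mean (\<lambda>z. \<bar>ln (cmod (?l1 z)) - ln (cmod (?l2 z))\<bar>) r \<le> ?K * sqrt r \<and>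
        (\<Sum>a\<in>zeros_in ?l1 r. real (zmul ?l1 a)) \<le> ?K * sqrt r \<and>
        (\<Sum>a\<in>zeros_in ?l2 r. real (zmul ?l2 a)) \<le> ?K * sqrt r"
        using order_trans[OF 1 le] order_trans[OF 3 le] order_trans[OF 4 le] by simp
    qed
  qed
  thus ?thesis by (rule that)
qed

section \<open>Rational and invariant quotients\<close>

lemma rational_imp_not_transcendental:
  assumes g: "mero_rep g A B" and U: "U \<noteq> 0" and eq: "\<And>z. poly U z * A z = poly V z * B z"
  shows "\<not> transcendental g"
proof -
  have "g z = poly V z / poly U z" if "poly U z \<noteq> 0" for z
  proof -
    have "B z \<noteq> 0"
    proof
      assume "B z = 0"
      hence "A z = 0" using eq[of z] that by simp
      thus False using g \<open>B z = 0\<close> by (simp add: mero_rep_def)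
    qed
    thus ?thesis using g eq[of z] that by (simp add: mero_rep_def field_simps)
  qed
  thus ?thesis using U unfolding transcendental_def by blast
qed

lemma entire_nz_lform:
  assumes g: "mero_rep g A B" and tr: "transcendental g"
  shows "entire_nz (lform A B v)"
proof (cases v)
  case None
  have "lform A B v = B" by (auto simp: None)
  thus ?thesis using g by (simp add: mero_rep_def)
next
  case (Some a)
  have hol: "lform A B v holomorphic_on UNIV"
  proof -
    have "(\<lambda>z. A z - a * B z) holomorphic_on UNIV"
      using g by (intro holomorphic_intros) (auto simp: mero_rep_def intro: entire_nz_holomorphic)
    moreover have "lform A B v = (\<lambda>z. A z - a * B z)" by (auto simp: Some)
    ultimately show ?thesis by simp
  qed
  moreover have "\<exists>z. lform A B v z \<noteq> 0"
  proof (rule ccontr)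
    assume "\<nexists>z. lform A B v z \<noteq> 0"
    hence "poly 1 z * A z = poly [:a:] z * B z" for z by (simp add: Some)
    thus False using rational_imp_not_transcendental[OF g, of 1 "[:a:]"] tr by simp
  qed
  ultimately show ?thesis by (simp add: entire_nz_def)
qed

text \<open>The hypothesis is the invariance of \<open>g\<close> under the affine map,
  cross-multiplied to cover poles. Iteration moves every point to the fixed point \<open>p\<close>,
  so by continuity \<open>g\<close> is constant.\<close>

lemma proportional_affine_imp_not_transcendental:
  assumes g: "mero_rep g A B" and q: "cmod q < 1"
    and eq: "\<And>z. A (q * z + c) * B z = A z * B (q * z + c)"
  shows "\<not> transcendental g"
proof -
  have A: "A holomorphic_on UNIV" and B: "entire_nz B" and cop: "\<And>z. A z = 0 \<Longrightarrow> B z \<noteq> 0"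
    using g by (auto simp: mero_rep_def)
  define p where "p = c / (1 - q)"
  have "1 - q \<noteq> 0" using q by auto
  hence p: "q * p + c = p" by (simp add: p_def field_simps)
  define orb where "orb = (\<lambda>k z. p + q ^ k * (z - p))"
  have orb_Suc: "orb (Suc k) z = q * orb k z + c" for k z
    using p by (simp add: orb_def algebra_simps)
  have par: "A (orb k z) * B z = A z * B (orb k z)" for k z
  proof (induction k)
    case 0
    thus ?case by (simp add: orb_def)
  next
    case (Suc k)
    have step: "A (orb (Suc k) z) * B (orb k z) = A (orb k z) * B (orb (Suc k) z)"
      unfolding orb_Suc by (rule eq)
    \<comment> \<open>Proportionality of the pairs \<open>(A, B)\<close> is transitive because no
      pair is \<open>(0, 0)\<close>. If \<open>B\<close> vanishes at the middle point, it vanishes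
      at the other two.\<close>
    show ?case
    proof (cases "B (orb k z) = 0")
      case True
      hence "A (orb k z) \<noteq> 0" using cop by blast
      hence "B z = 0" "B (orb (Suc k) z) = 0" using True Suc step by auto
      thus ?thesis by simp
    next
      case False
      have "B (orb k z) * (A (orb (Suc k) z) * B z) = B (orb k z) * (A z * B (orb (Suc k) z))"
        using Suc step by algebra
      thus ?thesis using False by simp
    qed
  qed
  have limit: "A p * B z = A z * B p" for z
  proof -
    have "(\<lambda>k. orb k z) \<longlonglongrightarrow> p + 0 * (z - p)"
      unfolding orb_def by (intro tendsto_intros LIMSEQ_power_zero q)
    hence orb: "(\<lambda>k. orb k z) \<longlonglongrightarrow> p" by simp
    have "isCont A p" "isCont B p"
      using A entire_nz_continuous[OF B, of UNIV]
      by (auto intro: continuous_on_interior holomorphic_on_imp_continuous_on)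
    hence "(\<lambda>k. A (orb k z) * B z) \<longlonglongrightarrow> A p * B z" "(\<lambda>k. A z * B (orb k z)) \<longlonglongrightarrow> A z * B p"
      by (auto intro!: tendsto_intros isCont_tendsto_compose[OF _ orb])
    thus ?thesis unfolding par by (rule LIMSEQ_unique)
  qed
  have "B p \<noteq> 0"
  proof
    assume "B p = 0"
    hence "A p \<noteq> 0" using cop by blast
    hence "B z = 0" for z using limit[of z] \<open>B p = 0\<close> by simp
    thus False using B by (auto simp: entire_nz_def)
  qed
  thus ?thesis
    using rational_imp_not_transcendental[OF g, of "[:B p:]" "[:A p:]"] limit by (simp add: mult.commute)
qed

section \<open>Elimination among three linear forms\<close>

definition lin_poly :: "complex set \<Rightarrow> (complex \<Rightarrow> nat) \<Rightarrow> complex poly" where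
  "lin_poly S m = (\<Prod>a\<in>S. [:-a, 1:] ^ m a)"

lemma poly_lin_poly: "poly (lin_poly S m) z = lin_prod S m z"
  by (simp add: lin_poly_def lin_prod_def poly_prod)

lemma lin_poly_nz: "finite S \<Longrightarrow> lin_poly S m \<noteq> 0"
  by (simp add: lin_poly_def)

lemma entire_nz_poly: "p \<noteq> 0 \<Longrightarrow> entire_nz (poly p)"
  using poly_all_0_iff_0[of p] by (auto simp: entire_nz_def intro!: holomorphic_intros)

fun coeff_A :: "complex option \<Rightarrow> complex" where
  "coeff_A (Some a) = 1" | "coeff_A None = 0"

fun coeff_B :: "complex option \<Rightarrow> complex" where
  "coeff_B (Some a) = -a" | "coeff_B None = 1"

lemma lform_coeff: "lform A B v z = coeff_A v * A z + coeff_B v * B z"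
  by (cases v) auto

text \<open>Forms of distinct values are linearly independent, infinity included.\<close>

lemma coeff_det_nz: "u \<noteq> v \<Longrightarrow> coeff_A u * coeff_B v - coeff_A v * coeff_B u \<noteq> 0"
  by (cases u; cases v) auto

text \<open>Three forms in \<open>A\<close> and \<open>B\<close> are linearly dependent. Comparing
  this relation with its image under the affine map eliminates the third form and leaves a relation
  of the first two with polynomial coefficients. If it is nontrivial, \<open>g\<close> is rational;
  if trivial, the quotient of the first and third forms is invariant.\<close>

lemma three_forms_impossible:
  assumes g: "mero_rep g A B" and tr: "transcendental g" and q: "0 < cmod q" "cmod q < 1"
    and dist: "v1 \<noteq> v2" "v1 \<noteq> v3" "v2 \<noteq> v3"
    and X: "\<And>v. v \<in> {v1, v2, v3} \<Longrightarrow> finite (X v)"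
    and eq: "\<And>v z. v \<in> {v1, v2, v3} \<Longrightarrow>
       lin_prod (X v) (m v) z * lform A B v (q * z + c) = exp (\<phi> v z) * (lin_prod (X v) (n v) z * lform A B v z)"
    and const: "\<And>v z. v \<in> {v1, v2, v3} \<Longrightarrow> \<phi> v z - \<phi> v3 z = \<phi> v 0 - \<phi> v3 0"
  shows False
proof -
  let ?l = "\<lambda>v. lform A B v"
  have B: "entire_nz B" using g by (simp add: mero_rep_def)
  define Q where "Q = (\<lambda>v. lin_poly (X v) (m v))"
  define P where "P = (\<lambda>v. lin_poly (X v) (n v))"
  define k where "k = (\<lambda>v. exp (\<phi> v 0 - \<phi> v3 0))"
  define D where "D = (\<lambda>u v. coeff_A u * coeff_B v - coeff_A v * coeff_B u)"
  define \<psi> where "\<psi> = (\<lambda>z. exp (\<phi> v3 z))"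
  have k3: "k v3 = 1" by (simp add: k_def)
  have Qnz: "Q v \<noteq> 0" if "v \<in> {v1, v2, v3}" for v using lin_poly_nz[OF X[OF that]] by (simp add: Q_def)
  have fe: "poly (Q v) z * ?l v (q * z + c) = k v * \<psi> z * (poly (P v) z * ?l v z)"
    if v: "v \<in> {v1, v2, v3}" for v z
  proof -
    have "\<phi> v z = (\<phi> v 0 - \<phi> v3 0) + \<phi> v3 z" using const[OF v, of z] by (simp add: algebra_simps)
    hence "exp (\<phi> v z) = k v * \<psi> z" by (metis k_def \<psi>_def exp_add)
    thus ?thesis using eq[OF v, of z] by (simp add: Q_def P_def poly_lin_poly)
  qed
  have fe1: "poly (Q v1) z * ?l v1 (q * z + c) = k v1 * \<psi> z * (poly (P v1) z * ?l v1 z)"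
    and fe2: "poly (Q v2) z * ?l v2 (q * z + c) = k v2 * \<psi> z * (poly (P v2) z * ?l v2 z)"
    and fe3: "poly (Q v3) z * ?l v3 (q * z + c) = \<psi> z * (poly (P v3) z * ?l v3 z)" for z
    using fe[of v1] fe[of v2] fe[of v3] by (simp_all add: k3)
  have rel: "D v2 v3 * ?l v1 z + D v3 v1 * ?l v2 z + D v1 v2 * ?l v3 z = 0" for z
    unfolding D_def lform_coeff by (simp add: algebra_simps)
  \<comment> \<open>The relation at \<open>q * z + c\<close> is multiplied by
    \<open>Q v1 * Q v2 * Q v3\<close>, the functional equations are inserted, and the third form is
    eliminated by the relation at \<open>z\<close>. These are the remaining coefficients, without
    the common factor \<open>\<psi> z\<close>.\<close>
  define u1 where "u1 = smult (D v2 v3) (Q v2 * (smult (k v1) (Q v3 * P v1) - Q v1 * P v3))"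
  define u2 where "u2 = smult (D v3 v1) (Q v1 * (smult (k v2) (Q v3 * P v2) - Q v2 * P v3))"
  have u_rel: "poly u1 z * ?l v1 z + poly u2 z * ?l v2 z = 0" for z
  proof -
    have "\<psi> z * (poly u1 z * ?l v1 z + poly u2 z * ?l v2 z) = 0"
      using rel[of "q * z + c"] rel[of z] fe1[of z] fe2[of z] fe3[of z]
      unfolding u1_def u2_def by (simp only: poly_smult poly_mult poly_diff) algebra
    thus ?thesis by (simp add: \<psi>_def)
  qed
  show False
  proof (cases "u1 = 0 \<and> u2 = 0")
    case True
    hence P13: "smult (k v1) (Q v3 * P v1) = Q v1 * P v3"
      using Qnz coeff_det_nz[OF dist(3)] by (simp add: u1_def D_def)
    \<comment> \<open>The functional equations and \<open>P13\<close> give this only after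
      multiplication by \<open>Q v1 * Q v3\<close>; a nonzero polynomial can be cancelled among
      entire functions.\<close>
    have W: "?l v1 (q * z + c) * ?l v3 z - ?l v3 (q * z + c) * ?l v1 z = 0" for z
    proof (rule ccontr)
      let ?W = "\<lambda>z. ?l v1 (q * z + c) * ?l v3 z - ?l v3 (q * z + c) * ?l v1 z"
      assume "?W z \<noteq> 0"
      moreover have "?W holomorphic_on UNIV"
        using q by (intro holomorphic_intros entire_nz_holomorphic entire_nz_affine entire_nz_lform[OF g tr]) auto
      ultimately have "entire_nz ?W" unfolding entire_nz_def by blast
      hence "entire_nz (\<lambda>z. poly (Q v1 * Q v3) z * ?W z)"
        using Qnz by (intro entire_nz_mult entire_nz_poly) auto
      moreover have "poly (Q v1 * Q v3) z * ?W z = 0" for z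
      proof -
        have "k v1 * (poly (Q v3) z * poly (P v1) z) = poly (Q v1) z * poly (P v3) z"
          using arg_cong[OF P13, of "\<lambda>p. poly p z"] by simp
        thus ?thesis using fe1[of z] fe3[of z] unfolding poly_mult by algebra
      qed
      ultimately show False by (auto simp: entire_nz_def)
    qed
    have "A (q * z + c) * B z = A z * B (q * z + c)" for z
    proof -
      \<comment> \<open>The determinant of the two forms is that of \<open>A\<close> and
        \<open>B\<close> times the determinant of the coefficients.\<close>
      have "D v1 v3 * (A (q * z + c) * B z - A z * B (q * z + c)) = 0"
        using W[of z] unfolding lform_coeff D_def by algebra
      thus ?thesis using coeff_det_nz[OF dist(2)] by (simp add: D_def)
    qed
    thus False using proportional_affine_imp_not_transcendental[OF g q(2)] tr by blast
  next
    case False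
    define U where "U = smult (coeff_A v1) u1 + smult (coeff_A v2) u2"
    define V where "V = - (smult (coeff_B v1) u1 + smult (coeff_B v2) u2)"
    have UV: "poly U z * A z = poly V z * B z" for z
      using u_rel[of z] unfolding U_def V_def lform_coeff
      by (simp only: poly_smult poly_add poly_minus) algebra
    have "U \<noteq> 0"
    proof
      assume U0: "U = 0"
      have "V = 0"
      proof (rule ccontr)
        assume "V \<noteq> 0"
        hence "entire_nz (\<lambda>z. poly V z * B z)" by (intro entire_nz_mult entire_nz_poly B)
        thus False using UV U0 by (auto simp: entire_nz_def)
      qed
      \<comment> \<open>Cramer's rule recovers \<open>u1\<close> and \<open>u2\<close> from
        \<open>U\<close> and \<open>V\<close>.\<close>
      have "smult (D v1 v2) u1 = smult (coeff_B v2) U + smult (coeff_A v2) V"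
        "smult (D v1 v2) u2 = - (smult (coeff_B v1) U + smult (coeff_A v1) V)"
        unfolding D_def U_def V_def by (simp_all add: algebra_simps smult_add_right smult_diff_left smult_diff_right smult_add_left)
      hence "u1 = 0 \<and> u2 = 0" using U0 \<open>V = 0\<close> coeff_det_nz[OF dist(1)] by (simp add: D_def)
      thus False using False by blast
    qed
    thus False using rational_imp_not_transcendental[OF g _ UV] tr by blast
  qed
qed

section \<open>Multiplicities and the Hahn difference operator\<close>

lemma zero_mult_cong:
  assumes "\<forall>\<^sub>F w in at z. f w = f' w"
  shows "zero_mult f z = zero_mult f' z"
proof -
  have "(\<forall>\<^sub>F w in at z. f w = 0) \<longleftrightarrow> (\<forall>\<^sub>F w in at z. f' w = 0)"
    by (rule eventually_cong[OF assms]) simp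
  moreover have "zorder f z = zorder f' z" by (rule zorder_cong[OF assms refl])
  ultimately show ?thesis by (simp add: zero_mult_def)
qed

text \<open>
  Multiplying \<open>h(q w + c) - h(w)\<close> by the denominators gives an entire function \<open>H\<close> that vanishes at
  \<open>z\<close> to order at least \<open>zmul l z\<close>; this forces the same for \<open>l(q w + c) D(w) = H(w) + l(w) D(q w + c)\<close>.
\<close>

lemma zmul_le_of_hahn_diff:
  assumes l: "entire_nz l" and D: "entire_nz D" and q: "q \<noteq> 0"
    and z: "l z = 0" "D z \<noteq> 0" "(q - 1) * z + c \<noteq> 0"
    and ord: "enat (zmul l z) \<le> zero_mult (hahn_diff q c (\<lambda>w. l w / D w)) z"
  shows "zmul l z \<le> zmul l (q * z + c)"
proof -
  let ?n = "zmul l z"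
  let ?hd = "hahn_diff q c (\<lambda>w. l w / D w)"
  define H where "H = (\<lambda>w. l (q * w + c) * D w - l w * D (q * w + c))"
  define E where "E = (\<lambda>w. ((q - 1) * w + c) * (D w * D (q * w + c)))"
  have lq: "entire_nz (\<lambda>w. l (q * w + c))" and Dq: "entire_nz (\<lambda>w. D (q * w + c))"
    using l D q by (auto intro: entire_nz_affine)
  have n: "?n > 0" using z zmul_eq_0_iff[OF l, of z] by auto
  have Hhol: "H holomorphic_on UNIV"
    unfolding H_def by (intro holomorphic_intros entire_nz_holomorphic l D lq Dq)
  have Dz: "zmul D z = 0" using z zmul_eq_0_iff[OF D] by simp
  have lD: "zmul (\<lambda>w. l (q * w + c) * D w) z = zmul l (q * z + c)"
    by (simp add: zmul_mult[OF lq D] Dz zmul_affine[OF l q])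
  have lD': "zmul (\<lambda>w. l w * D (q * w + c)) z \<ge> ?n"
    by (simp add: zmul_mult[OF l Dq])
  show ?thesis
  proof (cases "\<exists>w. H w \<noteq> 0")
    \<comment> \<open>Here the difference quotient vanishes identically near \<open>z\<close> and
      \<open>zorder\<close> says nothing about it; equality of the two products gives the claim
      directly.\<close>
    case False
    hence "(\<lambda>w. l (q * w + c) * D w) = (\<lambda>w. l w * D (q * w + c))" by (auto simp: H_def)
    thus ?thesis using lD lD' by simp
  next
    case True
    hence H: "entire_nz H" using Hhol by (auto simp: entire_nz_def)
    have lin: "entire_nz (\<lambda>w. (q - 1) * w + c)"
      using z(3) by (auto simp: entire_nz_def intro!: holomorphic_intros)
    have E: "entire_nz E" unfolding E_def by (intro entire_nz_mult lin D Dq)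
    have HE: "\<forall>\<^sub>F w in at z. H w = ?hd w * E w"
      using entire_nz_eventually[OF E, of z]
    proof eventually_elim
      case (elim w)
      have frac: "(L / b - m / a) / x * (x * (a * b)) = L * a - m * b" if "x \<noteq> 0" "a \<noteq> 0" "b \<noteq> 0"
        for L m a b x :: complex
        using that by (simp add: field_simps)
      show ?case
        unfolding E_def H_def hahn_diff_def by (rule frac[symmetric]) (use elim in \<open>auto simp: E_def\<close>)
    qed
    have hd_nz: "\<forall>\<^sub>F w in at z. ?hd w \<noteq> 0"
      using HE entire_nz_eventually[OF H, of z] by eventually_elim auto
    have "\<not> (\<forall>\<^sub>F w in at z. ?hd w = 0)"
      using eventually_frequently[OF at_neq_bot hd_nz] by (simp add: frequently_def)
    hence nle: "int ?n \<le> zorder ?hd z"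
      using ord n by (simp add: zero_mult_def)
    have mero: "?hd meromorphic_on {z}"
      unfolding hahn_diff_def
      by (intro meromorphic_intros analytic_on_imp_meromorphic_on entire_nz_analytic l D lq Dq lin)
    have "zorder H z = zorder (\<lambda>w. ?hd w * E w) z" by (rule zorder_cong[OF HE refl])
    also have "\<dots> = zorder ?hd z + zorder E z"
      by (rule zorder_mult[OF mero _ _ entire_nz_frequently[OF E]])
         (use hd_nz in \<open>auto intro: eventually_frequently analytic_on_imp_meromorphic_on entire_nz_analytic E\<close>)
    \<comment> \<open>\<open>E\<close> may vanish at \<open>z\<close> through
      \<open>D (q * z + c)\<close>; being entire, it can only raise the order.\<close>
    also have "\<dots> \<ge> int ?n" using nle int_zmul[OF E, of z] by simp
    finally have Hn: "zorder H z \<ge> int ?n" .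
    have prodnz: "entire_nz (\<lambda>w. l w * D (q * w + c))" "entire_nz (\<lambda>w. l (q * w + c) * D w)"
      by (intro entire_nz_mult l lq D Dq)+
    have sum_eq: "(\<lambda>w. H w + l w * D (q * w + c)) = (\<lambda>w. l (q * w + c) * D w)"
      by (auto simp: H_def)
    have "zorder (\<lambda>w. H w + l w * D (q * w + c)) z \<ge> int ?n"
    proof (rule zorder_add_ge)
      show "H meromorphic_on {z}" "(\<lambda>w. l w * D (q * w + c)) meromorphic_on {z}"
        by (intro analytic_on_imp_meromorphic_on entire_nz_analytic H prodnz)+
      show "\<exists>\<^sub>F w in at z. H w + l w * D (q * w + c) \<noteq> 0"
        using entire_nz_frequently[OF prodnz(2), of z] by (simp add: H_def)
      show "int ?n \<le> zorder (\<lambda>w. l w * D (q * w + c)) z"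
        using lD' int_zmul[OF prodnz(1), of z] by simp
    qed (intro entire_nz_frequently H prodnz Hn)+
    hence "int ?n \<le> int (zmul (\<lambda>w. l (q * w + c) * D w) z)"
      unfolding sum_eq int_zmul[OF prodnz(2)] .
    thus ?thesis using lD by simp
  qed
qed

lemma takes_value_iff_lform:
  assumes "mero_rep g A B"
  shows "takes_value g v z \<longleftrightarrow> lform A B v z = 0"
  using assms by (cases v) (auto simp: mero_rep_def field_simps)

lemma enat_diff_min_eq_0: "the_enat (enat n - min (enat n) m) = 0 \<Longrightarrow> enat n \<le> m"
  by (cases m) (auto simp: min_def split: if_splits)

text \<open>A vanishing summand means \<open>m'\<close> is at least \<open>n\<close>. For a finite
  value, \<open>g\<close> and the form over \<open>B\<close> differ by a constant, which the
  difference operator ignores; for infinity, \<open>B / A\<close> takes the place of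
  \<open>l / D\<close>.\<close>

lemma hahn_mult_0_imp_zmul_le:
  assumes g: "mero_rep g A B" and tr: "transcendental g" and q: "q \<noteq> 0"
    and z: "lform A B v z = 0" "(q - 1) * z + c \<noteq> 0" and hm: "hahn_mult q c g v z = 0"
  shows "zmul (lform A B v) z \<le> zmul (lform A B v) (q * z + c)"
proof -
  have B: "entire_nz B" and cop: "\<And>z. A z = 0 \<Longrightarrow> B z \<noteq> 0" and gAB: "\<And>z. g z = A z / B z"
    using g by (auto simp: mero_rep_def)
  have l: "entire_nz (lform A B v)" by (rule entire_nz_lform[OF g tr])
  show ?thesis
  proof (cases v)
    case (Some a)
    let ?l = "lform A B v"
    have Bz: "B z \<noteq> 0" using z(1) cop by (auto simp: Some)
    have Bq: "entire_nz (\<lambda>w. B (q * w + c))" by (rule entire_nz_affine[OF B q])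
    have ev: "\<forall>\<^sub>F w in at z. B w \<noteq> 0 \<and> B (q * w + c) \<noteq> 0"
      by (intro eventually_conj entire_nz_eventually B Bq)
    have ga: "g w - a = ?l w / B w" if "B w \<noteq> 0" for w
      using that by (simp add: gAB Some field_simps)
    have ev1: "\<forall>\<^sub>F w in at z. g w - a = ?l w / B w"
      using ev by eventually_elim (simp add: ga)
    have ev2: "\<forall>\<^sub>F w in at z. hahn_diff q c g w = hahn_diff q c (\<lambda>w. ?l w / B w) w"
      using ev
    proof eventually_elim
      case (elim w)
      hence nz: "B w \<noteq> 0" "B (q * w + c) \<noteq> 0" by auto
      have "g w = ?l w / B w + a" "g (q * w + c) = ?l (q * w + c) / B (q * w + c) + a"
        using ga[OF nz(1)] ga[OF nz(2)] by (simp_all only: diff_eq_eq)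
      thus ?case by (simp add: hahn_diff_def)
    qed
    have "zorder (\<lambda>w. g w - a) z = zorder (\<lambda>w. ?l w / B w) z"
      by (rule zorder_cong[OF ev1 refl])
    also have "\<dots> = zorder ?l z - zorder B z"
      by (rule zorder_divide) (intro analytic_on_imp_meromorphic_on entire_nz_analytic entire_nz_frequently l B)+
    also have "zorder B z = 0"
      using int_zmul[OF B, of z] zmul_eq_0_iff[OF B, of z] Bz by simp
    finally have zo: "zorder (\<lambda>w. g w - a) z = zorder ?l z" by simp
    have nz: "\<forall>\<^sub>F w in at z. g w - a \<noteq> 0"
      using ev ev1 entire_nz_eventually[OF l, of z] by eventually_elim simp
    have "\<not> (\<forall>\<^sub>F w in at z. g w - a = 0)"
      using eventually_frequently[OF at_neq_bot nz] by (simp add: frequently_def)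
    hence n: "zero_mult (\<lambda>w. g w - a) z = enat (zmul ?l z)"
      unfolding zero_mult_def zo zmul_def by simp
    have "enat (zmul ?l z) \<le> zero_mult (hahn_diff q c g) z"
      using hm unfolding Some hahn_mult.simps Let_def n[unfolded Some] by (rule enat_diff_min_eq_0)
    thus ?thesis
      using zero_mult_cong[OF ev2] by (intro zmul_le_of_hahn_diff[OF l B q z(1) Bz z(2)]) simp
  next
    case None
    have lB: "lform A B v = B" by (auto simp: None)
    have Bz: "B z = 0" using z by (simp add: lB)
    have A: "entire_nz A"
    proof -
      have "lform A B (Some 0) = A" by auto
      thus ?thesis using entire_nz_lform[OF g tr, of "Some 0"] by simp
    qed
    have n: "pole_mult g z = enat (zmul B z)"
      using g Bz by (auto simp: mero_rep_def pole_mult_def zmul_def)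
    \<comment> \<open>This holds everywhere: at zeros and poles of \<open>g\<close> both sides are 0
      by the convention for division by 0.\<close>
    have inv: "(\<lambda>w. 1 / g w) = (\<lambda>w. B w / A w)" by (simp add: gAB)
    have "enat (zmul B z) \<le> zero_mult (hahn_diff q c (\<lambda>w. B w / A w)) z"
      using hm unfolding None hahn_mult.simps Let_def n inv by (rule enat_diff_min_eq_0)
    thus ?thesis unfolding lB
      using cop Bz by (intro zmul_le_of_hahn_diff[OF B A q Bz _ z(2)]) auto
  qed
qed

text \<open>Each such point adds at least 1 to a bounded count. \<open>fin\<close> keeps the sum in
  \<open>hahn_count\<close> from being the default 0 of an infinite index set.\<close>

lemma exceptional_imp_finite_hahn_mult:
  assumes ex: "hahn_picard_exceptional q c g v"
    and fin: "\<And>r. finite {z. cmod z \<le> r \<and> takes_value g v z}"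
  shows "finite {z. takes_value g v z \<and> hahn_mult q c g v z \<noteq> 0}"
proof (rule ccontr)
  let ?S = "{z. takes_value g v z \<and> hahn_mult q c g v z \<noteq> 0}"
  assume inf: "infinite ?S"
  from ex have "(\<lambda>r. real (hahn_count q c g v r)) \<in> O[at_top](\<lambda>_. 1)"
    by (simp add: hahn_picard_exceptional_def)
  then obtain M where "\<forall>\<^sub>F r in at_top. norm (real (hahn_count q c g v r)) \<le> M * norm (1::real)"
    by (rule landau_o.bigE)
  then obtain r0 where r0: "\<And>r. r \<ge> r0 \<Longrightarrow> real (hahn_count q c g v r) \<le> M"
    by (auto simp: eventually_at_top_linorder)
  obtain F where F: "finite F" "card F = Suc (nat \<lceil>M\<rceil>)" "F \<subseteq> ?S"
    using infinite_arbitrarily_large[OF inf] by blast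
  define r where "r = Max (insert r0 (cmod ` F))"
  have r: "r \<ge> r0" "\<And>z. z \<in> F \<Longrightarrow> cmod z \<le> r" using F(1) by (auto simp: r_def)
  have "card F = (\<Sum>z\<in>F. 1)" by simp
  also have "\<dots> \<le> (\<Sum>z\<in>F. hahn_mult q c g v z)"
    using F(3) by (intro sum_mono) (auto simp: Suc_le_eq)
  also have "\<dots> \<le> hahn_count q c g v r"
    unfolding hahn_count_def by (rule sum_mono2[OF fin]) (use F r in auto)
  finally have "real (card F) \<le> M" using r0[OF r(1)] by linarith
  thus False using F(2) by linarith
qed

lemma exceptional_imp_finite_not_invariant:
  assumes g: "mero_rep g A B" and tr: "transcendental g" and q: "0 < cmod q" "cmod q < 1"
    and ex: "hahn_picard_exceptional q c g v"
  shows "finite {z. zmul (lform A B v) z \<noteq> zmul (lform A B v) (q * z + c)}"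
proof -
  let ?l = "lform A B v"
  have l: "entire_nz ?l" by (rule entire_nz_lform[OF g tr])
  have q0: "q \<noteq> 0" "q \<noteq> 1" using q by auto
  \<comment> \<open>The fixed point is added because the denominator of the difference quotient
    vanishes there.\<close>
  let ?E = "insert (c / (1 - q)) {z. takes_value g v z \<and> hahn_mult q c g v z \<noteq> 0}"
  show ?thesis
  proof (rule finite_not_invariant[OF q])
    show "finite {z. cmod z \<le> r \<and> 0 < zmul ?l z}" for r
      using finite_zeros_cball[OF l, of r] zmul_eq_0_iff[OF l] by (simp flip: neq0_conv)
    show "finite ?E"
      using exceptional_imp_finite_hahn_mult[OF ex] finite_zeros_cball[OF l]
      by (simp add: takes_value_iff_lform[OF g])
    fix z assume z: "z \<notin> ?E"
    show "zmul ?l z \<le> zmul ?l (q * z + c)"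
    proof (cases "?l z = 0")
      case False
      thus ?thesis using zmul_eq_0_iff[OF l, of z] by simp
    next
      case True
      have "(q - 1) * z + c \<noteq> 0"
      proof
        assume "(q - 1) * z + c = 0"
        hence "z = c / (1 - q)" using q0 by (simp add: field_simps)
        thus False using z by simp
      qed
      thus ?thesis
        using z True takes_value_iff_lform[OF g, of v z]
        by (intro hahn_mult_0_imp_zmul_le[OF g tr q0(1) True]) auto
    qed
  qed
qed

text \<open>Weierstrass factorization, with the zero-free factor put into the numerator.\<close>

lemma mero_rep_exists:
  assumes "g nicely_meromorphic_on UNIV"
  obtains A B where "mero_rep g A B"
proof -
  obtain h f1 f2 where *:
    "h holomorphic_on UNIV" "f1 holomorphic_on UNIV" "f2 holomorphic_on UNIV"
    "\<forall>z. f1 z = 0 \<longleftrightarrow> \<not>is_pole g z \<and> g z = 0"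
    "\<forall>z. f2 z = 0 \<longleftrightarrow> is_pole g z"
    "\<forall>z. \<not>is_pole g z \<longrightarrow> zorder f1 z = zorder g z"
    "\<forall>z. is_pole g z \<longrightarrow> zorder f2 z = -zorder g z"
    "\<forall>z. h z \<noteq> 0"
    "\<forall>z. g z = h z * f1 z / f2 z"
    by (rule weierstrass_factorization_meromorphic_UNIV[OF assms])
  have "\<exists>z. f2 z \<noteq> 0"
  proof (rule ccontr)
    assume "\<nexists>z. f2 z \<noteq> 0"
    \<comment> \<open>Division by 0 would make \<open>g\<close> the zero function, although every
      point would be a pole.\<close>
    hence "g = (\<lambda>_. 0)" "is_pole g 0" using * by auto
    thus False by simp
  qed
  hence "mero_rep g (\<lambda>z. h z * f1 z) f2"
    unfolding mero_rep_def entire_nz_def using * by (auto intro!: holomorphic_intros)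
  thus ?thesis by (rule that)
qed

text \<open>All exponents are compared with that of \<open>v3\<close>, on circles that avoid the
  zeros of \<open>B\<close> and of both forms.\<close>

lemma no_three_exceptional:
  assumes g: "mero_rep g A B" and tr: "transcendental g" and ord: "mero_order g = 0"
    and q: "0 < cmod q" "cmod q < 1" and dist: "v1 \<noteq> v2" "v1 \<noteq> v3" "v2 \<noteq> v3"
    and ex: "\<And>v. v \<in> {v1, v2, v3} \<Longrightarrow> hahn_picard_exceptional q c g v"
  shows False
proof -
  have q0: "q \<noteq> 0" using q by auto
  have B: "entire_nz B" using g by (simp add: mero_rep_def)
  note l = entire_nz_lform[OF g tr]
  define X where "X = (\<lambda>v. {z. zmul (lform A B v) z \<noteq> zmul (lform A B v) (q * z + c)})"
  have X: "finite (X v)" if "v \<in> {v1, v2, v3}" for v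
    unfolding X_def by (rule exceptional_imp_finite_not_invariant[OF g tr q ex[OF that]])
  have inv: "zmul (lform A B v) z = zmul (lform A B v) (q * z + c)" if "z \<notin> X v" for v z
    using that by (simp add: X_def)
  define m where "m = (\<lambda>v x. zmul (lform A B v) x - zmul (lform A B v) (q * x + c))"
  define n where "n = (\<lambda>v x. zmul (lform A B v) (q * x + c) - zmul (lform A B v) x)"
  have "\<exists>\<phi>. \<phi> holomorphic_on UNIV \<and> (\<forall>z. lin_prod (X v) (m v) z * lform A B v (q * z + c) =
       exp (\<phi> z) * (lin_prod (X v) (n v) z * lform A B v z))" if "v \<in> {v1, v2, v3}" for v
    unfolding m_def n_def using functional_equation[OF l q0 X[OF that] inv] by blast
  then obtain \<phi> where \<phi>: "\<And>v. v \<in> {v1, v2, v3} \<Longrightarrow> \<phi> v holomorphic_on UNIV"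
    "\<And>v z. v \<in> {v1, v2, v3} \<Longrightarrow> lin_prod (X v) (m v) z * lform A B v (q * z + c) =
       exp (\<phi> v z) * (lin_prod (X v) (n v) z * lform A B v z)"
    by metis
  have const: "\<phi> v z - \<phi> v3 z = \<phi> v 0 - \<phi> v3 0" if v: "v \<in> {v1, v2, v3}" for v z
  proof -
    have v3: "v3 \<in> {v1, v2, v3}" by simp
    obtain K where K: "\<forall>\<^sub>F r in at_top.
      (\<forall>z. cmod z = r \<or> cmod z = 2 * r \<longrightarrow> B z * (lform A B v z * lform A B v3 z) \<noteq> 0) \<longrightarrow>
        circ_mean (\<lambda>z. \<bar>ln (cmod (lform A B v z)) - ln (cmod (lform A B v3 z))\<bar>) r \<le> K * sqrt r \<and>
        (\<Sum>a\<in>zeros_in (lform A B v) r. real (zmul (lform A B v) a)) \<le> K * sqrt r \<and>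
        (\<Sum>a\<in>zeros_in (lform A B v3) r. real (zmul (lform A B v3) a)) \<le> K * sqrt r"
      using pair_growth[OF g l l order_0_imp_T_le_sqrt[OF ord]] by blast
    show ?thesis
    proof (rule exponent_difference_constant[OF q l[of v] l[of v3]
          entire_nz_mult[OF B entire_nz_mult[OF l[of v] l[of v3]]] _
          X[OF v] inv X[OF v3] inv \<phi>(1)[OF v] _ \<phi>(1)[OF v3] _ K])
      show "lin_prod (X v) (\<lambda>x. zmul (lform A B v) x - zmul (lform A B v) (q * x + c)) z * lform A B v (q * z + c) =
        exp (\<phi> v z) * (lin_prod (X v) (\<lambda>x. zmul (lform A B v) (q * x + c) - zmul (lform A B v) x) z * lform A B v z)" for z
        using \<phi>(2)[OF v, of z] by (simp only: m_def n_def)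
      show "lin_prod (X v3) (\<lambda>x. zmul (lform A B v3) x - zmul (lform A B v3) (q * x + c)) z * lform A B v3 (q * z + c) =
        exp (\<phi> v3 z) * (lin_prod (X v3) (\<lambda>x. zmul (lform A B v3) (q * x + c) - zmul (lform A B v3) x) z * lform A B v3 z)" for z
        using \<phi>(2)[OF v3, of z] by (simp only: m_def n_def)
    qed auto
  qed
  show False
    by (rule three_forms_impossible[OF g tr q dist X \<phi>(2) const])
qed

theorem theorem8:
  fixes q c :: complex and g :: "complex \<Rightarrow> complex"
  assumes "g nicely_meromorphic_on UNIV"
    and "transcendental g"
    and "mero_order g = 0"
    and "0 < cmod q" and "cmod q < 1"
  shows "finite {a. hahn_picard_exceptional q c g a}
       \<and> card {a. hahn_picard_exceptional q c g a} \<le> 2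
       \<and> (\<forall>a :: complex. \<not> hahn_picard_exceptional q c g (Some a) \<longrightarrow>
             infinite {z. takes_value g (Some a) z})"
proof -
  let ?E = "{a. hahn_picard_exceptional q c g a}"
  obtain A B where g: "mero_rep g A B" using mero_rep_exists[OF assms(1)] .
  have "finite ?E \<and> card ?E \<le> 2"
  proof (rule ccontr)
    assume *: "\<not> (finite ?E \<and> card ?E \<le> 2)"
    \<comment> \<open>Any failure, an infinite set of exceptional values included, yields three of
      them.\<close>
    obtain T where "T \<subseteq> ?E" "card T = 3"
    proof (cases "finite ?E")
      case True
      hence "3 \<le> card ?E" using * by simp
      thus ?thesis using obtain_subset_with_card_n that by metis
    next
      case False
      thus ?thesis using infinite_arbitrarily_large that by metis
    qed
    then obtain v1 v2 v3 where "T = {v1, v2, v3}" "v1 \<noteq> v2" "v1 \<noteq> v3" "v2 \<noteq> v3"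
      by (auto simp: card_3_iff)
    with \<open>T \<subseteq> ?E\<close> show False
      by (intro no_three_exceptional[OF g assms(2-5), of v1 v2 v3 c]) auto
  qed
  \<comment> \<open>Contrapositive: a value taken only finitely often has a bounded count and is
    therefore exceptional.\<close>
  moreover have "infinite {z. takes_value g (Some a) z}"
    if "\<not> hahn_picard_exceptional q c g (Some a)" for a
  proof
    let ?S = "{z. takes_value g (Some a) z}"
    assume fin: "finite ?S"
    have "hahn_count q c g (Some a) r \<le> (\<Sum>z\<in>?S. hahn_mult q c g (Some a) z)" for r
      unfolding hahn_count_def by (rule sum_mono2[OF fin]) auto
    hence "real (hahn_count q c g (Some a) r) \<le> real (\<Sum>z\<in>?S. hahn_mult q c g (Some a) z)" for r
      by (rule of_nat_mono)
    hence "(\<lambda>r. real (hahn_count q c g (Some a) r)) \<in> O[at_top](\<lambda>_. 1)"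
      by (intro bigoI[of _ "real (\<Sum>z\<in>?S. hahn_mult q c g (Some a) z)"]) (simp del: of_nat_sum)
    with that show False by (simp add: hahn_picard_exceptional_def)
  qed
  ultimately show ?thesis by blast
qed

end
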